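(* Let $k$ be an algebraically closed field, let $V$ and $W$ be algebraic varieties over $k$ (not assumed affine or irreducible), and let $u : V \rightarrow W$ be a regular morphism. For every non-negative integer $m$ and for $m = \infty$, the set $F_{m} = \{ y \in W : |u^{-1}(y)| = m \}$ is a constructible subset of $W$. Moreover, there is an integer $l$ such that $F_{j}$ is empty for all integers $j$ with $l < j < \infty$.
   Context: Varieties are classical algebraic varieties over $k$ with the Zariski topology; a not necessarily irreducible variety is a union of finitely many irreducible ones. $|A|$ is the number of elements of a set $A$, either an integer or $\infty$. A subset is locally closed if it is the intersection of an open set and a closed set, and constructible if it is a finite union of locally closed sets. *)

theory Defs
  imports
    "HOL-Analysis.Abstract_Topology"
    "HOL-Computational_Algebra.Polynomial"
    "HOL-Library.Extended_Nat"
begin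

section \<open>Affine algebraic sets\<close>

definition affine_space :: "nat \<Rightarrow> (nat \<Rightarrow> 'k) set" where
  "affine_space n = ({..<n} \<rightarrow>\<^sub>E UNIV)"

text \<open>The functions on affine \<open>n\<close>-space given by polynomials in the coordinates
  \<open>x 0, \<dots>, x (n - 1)\<close>.\<close>

inductive_set poly_funs :: "nat \<Rightarrow> ((nat \<Rightarrow> 'k::comm_ring_1) \<Rightarrow> 'k) set" for n :: nat where
  const: "(\<lambda>x. c) \<in> poly_funs n"
| coord: "i < n \<Longrightarrow> (\<lambda>x. x i) \<in> poly_funs n"
| add: "p \<in> poly_funs n \<Longrightarrow> q \<in> poly_funs n \<Longrightarrow> (\<lambda>x. p x + q x) \<in> poly_funs n"
| mult: "p \<in> poly_funs n \<Longrightarrow> q \<in> poly_funs n \<Longrightarrow> (\<lambda>x. p x * q x) \<in> poly_funs n"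

definition zero_locus :: "nat \<Rightarrow> ((nat \<Rightarrow> 'k::field) \<Rightarrow> 'k) set \<Rightarrow> (nat \<Rightarrow> 'k) set" where
  "zero_locus n S = {x \<in> affine_space n. \<forall>p\<in>S. p x = 0}"

definition algebraic_set :: "nat \<Rightarrow> (nat \<Rightarrow> 'k::field) set \<Rightarrow> bool" where
  "algebraic_set n Z \<longleftrightarrow> (\<exists>S. S \<subseteq> poly_funs n \<and> Z = zero_locus n S)"

definition zariski :: "nat \<Rightarrow> (nat \<Rightarrow> 'k::field) topology" where
  "zariski n = topology (\<lambda>U. U \<subseteq> affine_space n \<and> algebraic_set n (affine_space n - U))"

lemma algebraic_set_Un:
  assumes "algebraic_set n Y" "algebraic_set n Z"
  shows "algebraic_set n (Y \<union> Z)"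
proof -
  obtain S T where S: "S \<subseteq> poly_funs n" "Y = zero_locus n S"
    and T: "T \<subseteq> poly_funs n" "Z = zero_locus n T"
    using assms unfolding algebraic_set_def by blast
  let ?P = "{\<lambda>x. p x * q x | p q. p \<in> S \<and> q \<in> T}"
  have "?P \<subseteq> poly_funs n"
    using S(1) T(1) by (auto intro: poly_funs.mult)
  moreover have "Y \<union> Z = zero_locus n ?P"
  proof (intro equalityI subsetI)
    fix x assume "x \<in> Y \<union> Z"
    then show "x \<in> zero_locus n ?P"
      by (auto simp: S(2) T(2) zero_locus_def)
  next
    fix x assume x: "x \<in> zero_locus n ?P"
    have prod: "p x * q x = 0" if "p \<in> S" "q \<in> T" for p q
    proof -
      have "(\<lambda>x. p x * q x) \<in> ?P" using that by blast
      moreover have "\<forall>f\<in>?P. f x = 0"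
        using x unfolding zero_locus_def mem_Collect_eq by (rule conjunct2)
      ultimately have "(\<lambda>x. p x * q x) x = 0" by (rule bspec[rotated])
      then show ?thesis .
    qed
    have "(\<forall>p\<in>S. p x = 0) \<or> (\<forall>q\<in>T. q x = 0)"
      using prod mult_eq_0_iff by metis
    moreover have "x \<in> affine_space n"
      using x unfolding zero_locus_def mem_Collect_eq by (rule conjunct1)
    ultimately show "x \<in> Y \<union> Z"
      unfolding S(2) T(2) zero_locus_def by blast
  qed
  ultimately show ?thesis
    unfolding algebraic_set_def by blast
qed

lemma istopology_zariski:
  "istopology (\<lambda>U. U \<subseteq> affine_space n \<and> algebraic_set n (affine_space n - U))"
  unfolding istopology_def
proof (intro conjI allI impI)
  fix U V :: "(nat \<Rightarrow> 'k::field) set"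
  assume U: "U \<subseteq> affine_space n \<and> algebraic_set n (affine_space n - U)"
    and V: "V \<subseteq> affine_space n \<and> algebraic_set n (affine_space n - V)"
  show "U \<inter> V \<subseteq> affine_space n" using U by blast
  show "algebraic_set n (affine_space n - U \<inter> V)"
    using algebraic_set_Un[of n "affine_space n - U" "affine_space n - V"] U V
    by (simp add: Diff_Int)
next
  fix \<K> :: "(nat \<Rightarrow> 'k::field) set set"
  assume K: "\<forall>K\<in>\<K>. K \<subseteq> affine_space n \<and> algebraic_set n (affine_space n - K)"
  then show "\<Union>\<K> \<subseteq> affine_space n" by blast
  obtain S where S: "\<And>K. K \<in> \<K> \<Longrightarrow> S K \<subseteq> poly_funs n \<and> affine_space n - K = zero_locus n (S K)"
    using K unfolding algebraic_set_def by metis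
  have "affine_space n - \<Union>\<K> = zero_locus n (\<Union>K\<in>\<K>. S K)"
  proof (intro set_eqI iffI)
    fix x assume x: "x \<in> affine_space n - \<Union>\<K>"
    then have "x \<in> zero_locus n (S K)" if "K \<in> \<K>" for K
      using S[OF that] that by blast
    with x show "x \<in> zero_locus n (\<Union>K\<in>\<K>. S K)"
      by (auto simp: zero_locus_def)
  next
    fix x assume x: "x \<in> zero_locus n (\<Union>K\<in>\<K>. S K)"
    then have "x \<in> zero_locus n (S K)" if "K \<in> \<K>" for K
      using that by (auto simp: zero_locus_def)
    then have "x \<notin> K" if "K \<in> \<K>" for K
      using S[OF that] that by blast
    with x show "x \<in> affine_space n - \<Union>\<K>"
      by (auto simp: zero_locus_def)
  qed
  with S show "algebraic_set n (affine_space n - \<Union>\<K>)"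
    unfolding algebraic_set_def by blast
qed

lemma openin_zariski:
  "openin (zariski n) U \<longleftrightarrow> U \<subseteq> affine_space n \<and> algebraic_set n (affine_space n - U)"
  unfolding zariski_def using topology_inverse'[OF istopology_zariski] by metis

lemma topspace_zariski: "topspace (zariski n :: (nat \<Rightarrow> 'a::field) topology) = affine_space n"
proof -
  have "algebraic_set n (zero_locus n {\<lambda>x. 1 :: 'a})"
    unfolding algebraic_set_def using poly_funs.const by blast
  then have "openin (zariski n) (affine_space n :: (nat \<Rightarrow> 'a) set)"
    by (simp add: openin_zariski zero_locus_def)
  then show ?thesis
    by (meson openin_subset openin_topspace openin_zariski subset_antisym)
qed

lemma closedin_zariski: "closedin (zariski n) Z \<longleftrightarrow> algebraic_set n Z"
proof -
  have "Z \<subseteq> affine_space n" if "algebraic_set n Z"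
    using that unfolding algebraic_set_def zero_locus_def by auto
  then show ?thesis
    by (auto simp: closedin_def topspace_zariski openin_zariski double_diff)
qed


section \<open>Spaces with functions and varieties\<close>

text \<open>A topological space with a sheaf of \<open>'k\<close>-valued functions.  The set \<open>reg X U\<close> consists of the
  functions that are regular on \<open>U\<close>; it is only meaningful for open \<open>U\<close>, and only the values on
  \<open>U\<close> of its members matter.\<close>

record ('a, 'k) fspace =
  ztop :: "'a topology"
  reg :: "'a set \<Rightarrow> ('a \<Rightarrow> 'k) set"

definition space_with_functions :: "('a, 'k::field) fspace \<Rightarrow> bool" where
  "space_with_functions X \<longleftrightarrow>
    (\<forall>U. openin (ztop X) U \<longrightarrow>
      (\<forall>c. (\<lambda>x. c) \<in> reg X U) \<and>
      (\<forall>f\<in>reg X U. \<forall>g\<in>reg X U. (\<lambda>x. f x + g x) \<in> reg X U \<and> (\<lambda>x. f x * g x) \<in> reg X U) \<and>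
      (\<forall>f\<in>reg X U. \<forall>g. (\<forall>x\<in>U. g x = f x) \<longrightarrow> g \<in> reg X U) \<and>
      (\<forall>f\<in>reg X U. \<forall>U'. openin (ztop X) U' \<longrightarrow> U' \<subseteq> U \<longrightarrow> f \<in> reg X U')) \<and>
    (\<forall>\<U> f. (\<forall>U\<in>\<U>. openin (ztop X) U \<and> f \<in> reg X U) \<longrightarrow> f \<in> reg X (\<Union>\<U>))"

definition regular_morphism ::
    "('a, 'k) fspace \<Rightarrow> ('b, 'k) fspace \<Rightarrow> ('a \<Rightarrow> 'b) \<Rightarrow> bool" where
  "regular_morphism X Y \<phi> \<longleftrightarrow>
    continuous_map (ztop X) (ztop Y) \<phi> \<and>
    (\<forall>U. openin (ztop Y) U \<longrightarrow>
      (\<forall>f\<in>reg Y U. f \<circ> \<phi> \<in> reg X {x \<in> topspace (ztop X). \<phi> x \<in> U}))"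

definition isomorphic :: "('a, 'k) fspace \<Rightarrow> ('b, 'k) fspace \<Rightarrow> bool" where
  "isomorphic X Y \<longleftrightarrow>
    (\<exists>\<phi> \<psi>. regular_morphism X Y \<phi> \<and> regular_morphism Y X \<psi> \<and>
      (\<forall>x\<in>topspace (ztop X). \<psi> (\<phi> x) = x) \<and> (\<forall>y\<in>topspace (ztop Y). \<phi> (\<psi> y) = y))"

definition open_subspace :: "('a, 'k) fspace \<Rightarrow> 'a set \<Rightarrow> ('a, 'k) fspace" where
  "open_subspace X U = \<lparr>ztop = subtopology (ztop X) U, reg = reg X\<rparr>"

text \<open>The regular functions on an affine algebraic set are those that are locally quotients of
  polynomial functions.\<close>

definition affine_model :: "nat \<Rightarrow> (nat \<Rightarrow> 'k::field) set \<Rightarrow> (nat \<Rightarrow> 'k, 'k) fspace" where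
  "affine_model n Z =
    \<lparr>ztop = subtopology (zariski n) Z,
     reg = (\<lambda>U. {f. \<forall>x\<in>U. \<exists>N. openin (subtopology (zariski n) Z) N \<and> x \<in> N \<and> N \<subseteq> U \<and>
       (\<exists>p\<in>poly_funs n. \<exists>q\<in>poly_funs n. \<forall>y\<in>N. q y \<noteq> 0 \<and> f y = p y / q y)})\<rparr>"

definition prevariety :: "('a, 'k::field) fspace \<Rightarrow> bool" where
  "prevariety X \<longleftrightarrow> space_with_functions X \<and>
    (\<exists>\<U>. finite \<U> \<and> \<Union>\<U> = topspace (ztop X) \<and>
      (\<forall>U\<in>\<U>. openin (ztop X) U \<and>
        (\<exists>n Z. algebraic_set n Z \<and> isomorphic (open_subspace X U) (affine_model n Z))))"

text \<open>Separatedness in the form that avoids products: two morphisms from an affine variety agree on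
  a closed set.\<close>

definition separated :: "('a, 'k::field) fspace \<Rightarrow> bool" where
  "separated X \<longleftrightarrow>
    (\<forall>n Z \<phi> \<psi>. algebraic_set n Z \<longrightarrow>
      regular_morphism (affine_model n Z) X \<phi> \<longrightarrow> regular_morphism (affine_model n Z) X \<psi> \<longrightarrow>
      closedin (ztop (affine_model n Z)) {z \<in> Z. \<phi> z = \<psi> z})"

definition variety :: "('a, 'k::field) fspace \<Rightarrow> bool" where
  "variety X \<longleftrightarrow> prevariety X \<and> separated X"


section \<open>Constructible sets and fibre cardinalities\<close>

definition locally_closed_in :: "'a topology \<Rightarrow> 'a set \<Rightarrow> bool" where
  "locally_closed_in T A \<longleftrightarrow> (\<exists>U C. openin T U \<and> closedin T C \<and> A = U \<inter> C)"

definition constructible_in :: "'a topology \<Rightarrow> 'a set \<Rightarrow> bool" where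
  "constructible_in T A \<longleftrightarrow> (\<exists>\<A>. finite \<A> \<and> (\<forall>B\<in>\<A>. locally_closed_in T B) \<and> A = \<Union>\<A>)"

definition ecard :: "'a set \<Rightarrow> enat" where
  "ecard A = (if finite A then enat (card A) else \<infinity>)"

definition fibre :: "('a, 'k) fspace \<Rightarrow> ('a \<Rightarrow> 'b) \<Rightarrow> 'b \<Rightarrow> 'a set" where
  "fibre V u y = {x \<in> topspace (ztop V). u x = y}"

definition fibre_card_locus ::
    "('a, 'k) fspace \<Rightarrow> ('b, 'k) fspace \<Rightarrow> ('a \<Rightarrow> 'b) \<Rightarrow> enat \<Rightarrow> 'b set" where
  "fibre_card_locus V W u m = {y \<in> topspace (ztop W). ecard (fibre V u y) = m}"

end

theory Submission
  imports Defs "HOL-Library.Disjoint_Sets"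
begin

text \<open>
  The proof is by elimination of quantifiers.  Call a predicate on affine space quantifier-free
  if it is a Boolean combination of polynomial equations; over an algebraically closed field,
  existential quantification over any number of coordinates leads from quantifier-free predicates
  to quantifier-free predicates (\<open>qf_ex_many\<close>).  Let \<open>E\<close> be a subset of the product of
  affine \<open>n\<close>-space and affine \<open>m\<close>-space defined by such a predicate, and
  \<open>E\<^sub>y\<close> its slice over \<open>y\<close>.

  That \<open>E\<^sub>y\<close> has at least \<open>j\<close> points means that there are \<open>j\<close> pairwise distinct
  \<open>m\<close>-tuples in it, which is an existential condition on \<open>y\<close>, hence quantifier-free
  (\<open>qf_slice_card_ge\<close>).  Moreover the finite slices have bounded size
  (\<open>qf_slice_bounded\<close>): a finite slice lies in the product of its \<open>m\<close> coordinate
  projections, each of which is a finite subset of the line cut out by polynomials in one variable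
  whose degrees are bounded independently of \<open>y\<close>.  So the locus where the slice has exactly \<open>j\<close> points
  is quantifier-free, and so is the locus where it is infinite, since this means having more
  points than the bound.

  To reduce the theorem to this situation, cover both varieties by finitely many affine charts and
  cut the domain into the disjoint differences \<open>D\<^sub>i\<close> of each chart and the previous ones.
  Over a chart of the codomain, a fibre is the disjoint union of its parts in the
  \<open>D\<^sub>i\<close>, and each part is in bijection with a slice of the graph of the morphism in
  coordinates.  This graph is quantifier-free (\<open>morphism_graph_qf\<close>): a regular function is
  locally a quotient of polynomials, and finitely many such quotients suffice because, by Hilbert's
  basis theorem (\<open>hilbert_basis\<close>), the Zariski topology is Noetherian.
\<close>

section \<open>Ideals of polynomial functions and the basis theorem\<close>

text \<open>The ideal generated by \<open>S\<close> in the ring of polynomial functions in \<open>n\<close> coordinates.\<close>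

inductive_set poly_ideal ::
    "nat \<Rightarrow> ((nat \<Rightarrow> 'k::comm_ring_1) \<Rightarrow> 'k) set \<Rightarrow> ((nat \<Rightarrow> 'k) \<Rightarrow> 'k) set"
  for n :: nat and S :: "((nat \<Rightarrow> 'k) \<Rightarrow> 'k) set" where
  zero: "(\<lambda>x. 0) \<in> poly_ideal n S"
| step: "f \<in> poly_ideal n S \<Longrightarrow> p \<in> poly_funs n \<Longrightarrow> s \<in> S \<Longrightarrow>
    (\<lambda>x. f x + p x * s x) \<in> poly_ideal n S"

lemma poly_ideal_add:
  assumes "f \<in> poly_ideal n S" "g \<in> poly_ideal n S"
  shows "(\<lambda>x. f x + g x) \<in> poly_ideal n S"
  using assms(2)
proof induction
  case zero
  then show ?case using assms(1) by simp
next
  case (step g p s)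
  from poly_ideal.step[OF step.IH step.hyps(2,3)] show ?case by (simp add: add.assoc)
qed

lemma poly_ideal_mult:
  assumes "f \<in> poly_ideal n S" "p \<in> poly_funs n"
  shows "(\<lambda>x. p x * f x) \<in> poly_ideal n S"
  using assms(1)
proof induction
  case zero
  then show ?case by (simp add: poly_ideal.zero)
next
  case (step g q s)
  from poly_ideal.step[OF step.IH poly_funs.mult[OF assms(2) step.hyps(2)] step.hyps(3)]
  show ?case by (simp add: algebra_simps)
qed

lemma poly_ideal_superset: "s \<in> S \<Longrightarrow> s \<in> poly_ideal n S"
  using poly_ideal.step[OF poly_ideal.zero poly_funs.const[of 1]] by fastforce

lemma poly_ideal_trans:
  assumes "S \<subseteq> poly_ideal n T" shows "poly_ideal n S \<subseteq> poly_ideal n T"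
proof
  fix f assume "f \<in> poly_ideal n S"
  then show "f \<in> poly_ideal n T"
  proof induction
    case (step f p s)
    then show ?case using assms by (intro poly_ideal_add poly_ideal_mult) auto
  qed (rule poly_ideal.zero)
qed

lemma poly_ideal_mono: "S \<subseteq> T \<Longrightarrow> poly_ideal n S \<subseteq> poly_ideal n T"
  by (rule poly_ideal_trans) (auto intro: poly_ideal_superset)

lemma poly_ideal_subset_poly_funs:
  assumes "S \<subseteq> poly_funs n" shows "poly_ideal n S \<subseteq> poly_funs n"
proof
  fix f assume "f \<in> poly_ideal n S"
  then show "f \<in> poly_funs n"
  proof induction
    case (step f p s)
    then show ?case using assms by (intro poly_funs.add poly_funs.mult) auto
  qed (rule poly_funs.const)
qed

lemma poly_ideal_vanish:
  assumes "f \<in> poly_ideal n S" "\<And>s. s \<in> S \<Longrightarrow> s x = 0" shows "f x = 0"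
  using assms
proof induction
  case (step f p s)
  then have "f x = 0" "s x = 0" by blast+
  then show ?case by simp
qed simp

lemma poly_ideal_finite_support:
  assumes "f \<in> poly_ideal n S"
  shows "\<exists>T. finite T \<and> T \<subseteq> S \<and> f \<in> poly_ideal n T"
  using assms
proof induction
  case zero
  then show ?case using poly_ideal.zero by blast
next
  case (step f p s)
  then obtain T where T: "finite T" "T \<subseteq> S" "f \<in> poly_ideal n T" by blast
  have "f \<in> poly_ideal n (insert s T)"
    by (rule subsetD[OF poly_ideal_mono T(3)]) blast
  then have "(\<lambda>x. f x + p x * s x) \<in> poly_ideal n (insert s T)"
    using step.hyps by (auto intro: poly_ideal.step)
  then show ?case using T step.hyps by (intro exI[of _ "insert s T"]) auto
qed

lemma poly_ideal_finite_support_set: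
  assumes "finite F" "F \<subseteq> poly_ideal n S"
  shows "\<exists>T. finite T \<and> T \<subseteq> S \<and> F \<subseteq> poly_ideal n T"
  using assms
proof induction
  case empty
  then show ?case by blast
next
  case (insert f F)
  obtain T where T: "finite T" "T \<subseteq> S" "F \<subseteq> poly_ideal n T" using insert by auto
  obtain T' where T': "finite T'" "T' \<subseteq> S" "f \<in> poly_ideal n T'"
    using poly_ideal_finite_support[of f n S] insert.prems by auto
  have "F \<subseteq> poly_ideal n (T \<union> T')" "f \<in> poly_ideal n (T \<union> T')"
    using subset_trans[OF T(3) poly_ideal_mono[OF Un_upper1]]
      subsetD[OF poly_ideal_mono[OF Un_upper2] T'(3)] by blast+
  then show ?case using T T' by (intro exI[of _ "T \<union> T'"]) auto
qed

lemma poly_funs_minus: "p \<in> poly_funs n \<Longrightarrow> (\<lambda>x. - p x) \<in> poly_funs n"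
  using poly_funs.mult[OF poly_funs.const[of "-1"], of p n] by simp

lemma poly_funs_power: "p \<in> poly_funs n \<Longrightarrow> (\<lambda>x. p x ^ j) \<in> poly_funs n"
proof (induction j)
  case (Suc j)
  then show ?case using poly_funs.mult[of p n "\<lambda>x. p x ^ j"] by simp
qed (simp add: poly_funs.const)

lemma poly_funs_mono: "p \<in> poly_funs n \<Longrightarrow> n \<le> m \<Longrightarrow> p \<in> poly_funs m"
proof (induction rule: poly_funs.induct)
  case (coord i)
  then show ?case by (intro poly_funs.coord) auto
qed (simp_all add: poly_funs.const poly_funs.add poly_funs.mult)

text \<open>The polynomial functions in \<open>n + 1\<close> coordinates that can be written with degree less than
  \<open>d\<close> in the last coordinate \<open>x n\<close>.  The coefficient \<open>c\<close> of the highest power need not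
  be determined by the function; the arguments below only use its existence.\<close>

fun poly_level :: "nat \<Rightarrow> nat \<Rightarrow> ((nat \<Rightarrow> 'k::comm_ring_1) \<Rightarrow> 'k) set" where
  "poly_level n 0 = {\<lambda>x. 0}"
| "poly_level n (Suc d) =
    {\<lambda>x. g x + c x * x n ^ d | g c. g \<in> poly_level n d \<and> c \<in> poly_funs n}"

lemma poly_level_SucI:
  "g \<in> poly_level n d \<Longrightarrow> c \<in> poly_funs n \<Longrightarrow> (\<lambda>x. g x + c x * x n ^ d) \<in> poly_level n (Suc d)"
  by auto

lemma poly_level_SucE:
  assumes "f \<in> poly_level n (Suc d)"
  obtains g c where "g \<in> poly_level n d" "c \<in> poly_funs n" "f = (\<lambda>x. g x + c x * x n ^ d)"
  using assms by auto

lemma zero_in_poly_level: "(\<lambda>x. 0) \<in> poly_level n d"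
proof (induction d)
  case (Suc d)
  from poly_level_SucI[OF Suc poly_funs.const[of 0]] show ?case by simp
qed simp

lemma poly_level_Suc: "f \<in> poly_level n d \<Longrightarrow> f \<in> poly_level n (Suc d)"
  using poly_level_SucI[OF _ poly_funs.const[of 0]] by fastforce

lemma poly_level_mono: "f \<in> poly_level n d \<Longrightarrow> d \<le> e \<Longrightarrow> f \<in> poly_level n e"
  by (induction e) (auto simp: le_Suc_eq simp del: poly_level.simps(2) intro: poly_level_Suc)

lemma poly_level_add:
  "f \<in> poly_level n d \<Longrightarrow> g \<in> poly_level n d \<Longrightarrow> (\<lambda>x. f x + g x) \<in> poly_level n d"
proof (induction d arbitrary: f g)
  case (Suc d)
  obtain f' c where f: "f' \<in> poly_level n d" "c \<in> poly_funs n" "f = (\<lambda>x. f' x + c x * x n ^ d)"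
    using Suc.prems(1) by (rule poly_level_SucE)
  obtain g' e where g: "g' \<in> poly_level n d" "e \<in> poly_funs n" "g = (\<lambda>x. g' x + e x * x n ^ d)"
    using Suc.prems(2) by (rule poly_level_SucE)
  have "(\<lambda>x. (f' x + g' x) + (c x + e x) * x n ^ d) \<in> poly_level n (Suc d)"
    by (intro poly_level_SucI Suc.IH poly_funs.add f g)
  then show ?case unfolding f g by (simp add: algebra_simps del: poly_level.simps)
qed simp

lemma poly_level_mult:
  "f \<in> poly_level n d \<Longrightarrow> p \<in> poly_funs n \<Longrightarrow> (\<lambda>x. p x * f x * x n ^ j) \<in> poly_level n (d + j)"
proof (induction d arbitrary: f)
  case 0
  then show ?case using zero_in_poly_level[of n j] by simp
next
  case (Suc d)
  obtain f' c where f: "f' \<in> poly_level n d" "c \<in> poly_funs n" "f = (\<lambda>x. f' x + c x * x n ^ d)"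
    using Suc.prems(1) by (rule poly_level_SucE)
  have "(\<lambda>x. p x * f' x * x n ^ j + (p x * c x) * x n ^ (d + j)) \<in> poly_level n (Suc (d + j))"
    by (intro poly_level_SucI Suc.IH poly_funs.mult f Suc.prems)
  then show ?case unfolding f by (simp add: algebra_simps power_add del: poly_level.simps)
qed

lemma poly_funs_Suc_level:
  assumes "f \<in> poly_funs (Suc n)" shows "\<exists>d. f \<in> poly_level n d"
  using assms
proof induction
  case (const c)
  from poly_level_SucI[OF zero_in_poly_level poly_funs.const[of c], of n 0]
  show ?case by (auto simp del: poly_level.simps)
next
  case (coord i)
  show ?case
  proof (cases "i = n")
    case True
    from poly_level_SucI[OF zero_in_poly_level poly_funs.const[of 1], of n 1]
    show ?thesis using True by (auto simp del: poly_level.simps)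
  next
    case False
    from poly_level_SucI[OF zero_in_poly_level poly_funs.coord[of i n], of 0]
    show ?thesis using False coord by (auto simp del: poly_level.simps)
  qed
next
  case (add p q)
  then obtain d e where "p \<in> poly_level n d" "q \<in> poly_level n e" by blast
  then have "p \<in> poly_level n (max d e)" "q \<in> poly_level n (max d e)"
    by (auto elim: poly_level_mono)
  then show ?case using poly_level_add by blast
next
  case (mult p q)
  then obtain d e where p: "p \<in> poly_level n d" and q: "q \<in> poly_level n e" by blast
  from q show ?case
  proof (induction e arbitrary: q)
    case 0
    then have "(\<lambda>x. p x * q x) \<in> poly_level n 0" by simp
    then show ?case ..
  next
    case (Suc e)
    obtain g c where g: "g \<in> poly_level n e" "c \<in> poly_funs n" "q = (\<lambda>x. g x + c x * x n ^ e)"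
      using Suc.prems by (rule poly_level_SucE)
    obtain d' where "(\<lambda>x. p x * g x) \<in> poly_level n d'" using Suc.IH g(1) by blast
    then have "(\<lambda>x. p x * g x) \<in> poly_level n (max d' (d + e))"
      by (auto elim: poly_level_mono)
    moreover have "(\<lambda>x. c x * p x * x n ^ e) \<in> poly_level n (max d' (d + e))"
      using poly_level_mult[OF p g(2), of e] by (auto elim: poly_level_mono)
    ultimately have "(\<lambda>x. p x * g x + c x * p x * x n ^ e) \<in> poly_level n (max d' (d + e))"
      by (rule poly_level_add)
    then show ?case unfolding g by (auto simp: algebra_simps)
  qed
qed

lemma poly_funs_0: "p \<in> poly_funs 0 \<Longrightarrow> \<exists>c. p = (\<lambda>x. c)"
  by (induction rule: poly_funs.induct) auto

text \<open>Hilbert's argument, by induction on the number of coordinates.  If an ideal \<open>I\<close> in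
  \<open>n + 1\<close> coordinates is not finitely generated, choose functions \<open>f k\<close> in \<open>I\<close> outside
  the ideal generated by the earlier ones and of minimal degree \<open>d k\<close> in the last coordinate.
  Their leading coefficients \<open>c k\<close> are functions of \<open>n\<close> coordinates, so that some
  \<open>c k\<close> lies in the ideal generated by the earlier ones.  Since the degrees do not decrease, the
  leading term of \<open>f k\<close> can then be cancelled by a combination of earlier functions, against
  the minimality of its degree.\<close>

theorem hilbert_basis:
  fixes S :: "((nat \<Rightarrow> 'k::field) \<Rightarrow> 'k) set"
  assumes "S \<subseteq> poly_funs n"
  shows "\<exists>T. finite T \<and> T \<subseteq> S \<and> S \<subseteq> poly_ideal n T"
  using assms
proof (induction n arbitrary: S)
  case 0
  show ?case
  proof (cases "S \<subseteq> {\<lambda>x. 0}")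
    case True
    then show ?thesis by (intro exI[of _ "{}"]) (auto intro: poly_ideal.zero)
  next
    case False
    then obtain s where s: "s \<in> S" "s \<noteq> (\<lambda>x. 0)" by blast
    obtain c where c: "s = (\<lambda>x. c)" using poly_funs_0[OF subsetD[OF 0 s(1)]] by blast
    have "f \<in> poly_ideal 0 {s}" if f: "f \<in> S" for f
    proof -
      obtain b where b: "f = (\<lambda>x. b)" using poly_funs_0[OF subsetD[OF 0 f]] by blast
      from poly_ideal.step[OF poly_ideal.zero poly_funs.const[of "b / c" 0], of s "{s}"]
      moreover have "c \<noteq> 0" using s(2) c by blast
      ultimately show ?thesis by (simp add: b c)
    qed
    then show ?thesis using s by (intro exI[of _ "{s}"]) auto
  qed
next
  case (Suc n)
  define I where "I = poly_ideal (Suc n) S"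
  have I_funs: "I \<subseteq> poly_funs (Suc n)"
    unfolding I_def using Suc.prems by (rule poly_ideal_subset_poly_funs)
  have "\<exists>T. finite T \<and> T \<subseteq> I \<and> I \<subseteq> poly_ideal (Suc n) T"
  proof (rule ccontr)
    assume "\<nexists>T. finite T \<and> T \<subseteq> I \<and> I \<subseteq> poly_ideal (Suc n) T"
    then have not_gen: "\<exists>g. g \<in> I \<and> g \<notin> poly_ideal (Suc n) T" if "finite T" "T \<subseteq> I" for T
      using that by blast
    \<comment> \<open>\<open>r\<close> is an admissible choice for \<open>f k\<close>, given the values of \<open>f\<close> below \<open>k\<close>\<close>
    let ?P = "\<lambda>f (k::nat) r. r \<in> I \<and> r \<notin> poly_ideal (Suc n) (f ` {..<k}) \<and>
      (\<exists>d. r \<in> poly_level n (Suc d) \<and>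
        (\<forall>g\<in>I. g \<notin> poly_ideal (Suc n) (f ` {..<k}) \<longrightarrow> g \<notin> poly_level n d))"
    have "\<exists>f. \<forall>k. ?P f k (f k)"
    proof (rule dependent_wf_choice[where P = ?P, OF wf_less_than])
      fix f g :: "nat \<Rightarrow> (nat \<Rightarrow> 'k) \<Rightarrow> 'k" and k r
      assume "\<And>j. (j, k) \<in> less_than \<Longrightarrow> f j = g j"
      then have "f ` {..<k} = g ` {..<k}" by (intro image_cong) auto
      then show "?P f k r = ?P g k r" by simp
    next
      fix k and f :: "nat \<Rightarrow> (nat \<Rightarrow> 'k) \<Rightarrow> 'k"
      assume f: "\<And>j. (j, k) \<in> less_than \<Longrightarrow> ?P f j (f j)"
      let ?J = "poly_ideal (Suc n) (f ` {..<k})"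
      have "f ` {..<k} \<subseteq> I" using f by auto
      then obtain g where g: "g \<in> I" "g \<notin> ?J" using not_gen by blast
      let ?Q = "\<lambda>d. \<exists>g\<in>I. g \<notin> ?J \<and> g \<in> poly_level n d"
      have ex: "\<exists>d. ?Q d" using poly_funs_Suc_level[OF subsetD[OF I_funs g(1)]] g by blast
      define d where "d = (LEAST d. ?Q d)"
      have d: "?Q d" unfolding d_def using ex by (rule LeastI_ex)
      have d_least: "\<not> ?Q e" if "e < d" for e
        using that unfolding d_def by (rule not_less_Least)
      have "d \<noteq> 0" using d poly_ideal.zero by (intro notI) auto
      then obtain e where e: "d = Suc e" using not0_implies_Suc by blast
      show "\<exists>r. ?P f k r" using d d_least[of e] unfolding e by blast
    qed
    then obtain f where f: "\<And>k. ?P f k (f k)" by blast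
    then obtain d where d: "\<And>k. f k \<in> poly_level n (Suc (d k))"
      and min: "\<And>k g. g \<in> I \<Longrightarrow> g \<notin> poly_ideal (Suc n) (f ` {..<k}) \<Longrightarrow> g \<notin> poly_level n (d k)"
      by metis
    have d_mono: "d i \<le> d k" if "i < k" for i k
    proof (rule ccontr)
      assume "\<not> d i \<le> d k"
      then have "f k \<in> poly_level n (d i)" using poly_level_mono[OF d[of k], of "d i"] by simp
      moreover have "f k \<notin> poly_ideal (Suc n) (f ` {..<i})"
      proof
        assume "f k \<in> poly_ideal (Suc n) (f ` {..<i})"
        moreover have "f ` {..<i} \<subseteq> f ` {..<k}" using that by (intro image_mono) auto
        ultimately have "f k \<in> poly_ideal (Suc n) (f ` {..<k})"
          using subsetD[OF poly_ideal_mono] by metis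
        then show False using f[of k] by blast
      qed
      ultimately show False using min f[of k] by blast
    qed
    have "\<forall>k. \<exists>c g. c \<in> poly_funs n \<and> g \<in> poly_level n (d k) \<and> f k = (\<lambda>x. g x + c x * x n ^ d k)"
      using d by (meson poly_level_SucE)
    from choice[OF this] obtain c where "\<forall>k. \<exists>g. c k \<in> poly_funs n \<and> g \<in> poly_level n (d k) \<and>
        f k = (\<lambda>x. g x + c k x * x n ^ d k)" ..
    from choice[OF this] obtain g where cg: "\<forall>k. c k \<in> poly_funs n \<and> g k \<in> poly_level n (d k) \<and>
        f k = (\<lambda>x. g k x + c k x * x n ^ d k)" ..
    then have c: "c k \<in> poly_funs n" and g: "g k \<in> poly_level n (d k)"
      and fk: "f k = (\<lambda>x. g k x + c k x * x n ^ d k)" for k by simp_all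
    obtain T where T: "finite T" "T \<subseteq> range c" "range c \<subseteq> poly_ideal n T"
      using Suc.IH[of "range c"] c by auto
    obtain K where K: "finite K" "T = c ` K" using finite_subset_image[OF T(1,2)] by blast
    then obtain k where k: "K \<subseteq> {..<k}" using finite_nat_iff_bounded by blast
    then have "poly_ideal n T \<subseteq> poly_ideal n (c ` {..<k})" using K by (intro poly_ideal_mono) auto
    then have ck: "c k \<in> poly_ideal n (c ` {..<k})" using T by blast
    \<comment> \<open>An element \<open>b\<close> of the ideal of the earlier leading coefficients is itself a leading
      coefficient, of degree \<open>d k\<close>, of an element of the ideal of the earlier functions.\<close>
    have "\<exists>h\<in>poly_ideal (Suc n) (f ` {..<k}). \<exists>g\<in>poly_level n (d k).
        h = (\<lambda>x. g x + b x * x n ^ d k)" if "b \<in> poly_ideal n (c ` {..<k})" for b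
      using that
    proof induction
      case zero
      then show ?case using poly_ideal.zero zero_in_poly_level
        by (intro bexI[of _ "\<lambda>x. 0"]) auto
    next
      case (step b p s)
      then obtain h g' where h: "h \<in> poly_ideal (Suc n) (f ` {..<k})" "g' \<in> poly_level n (d k)"
        "h = (\<lambda>x. g' x + b x * x n ^ d k)" by blast
      obtain i where i: "i < k" "s = c i" using step.hyps by blast
      let ?j = "d k - d i"
      have dk: "d k = d i + ?j" using d_mono[OF i(1)] by simp
      have "(\<lambda>x. p x * x n ^ ?j) \<in> poly_funs (Suc n)"
        using step.hyps(2) by (intro poly_funs.mult poly_funs_power poly_funs.coord)
          (auto elim: poly_funs_mono)
      then have ideal: "(\<lambda>x. h x + (p x * x n ^ ?j) * f i x) \<in> poly_ideal (Suc n) (f ` {..<k})"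
        using i by (intro poly_ideal.step h) auto
      define h2 where "h2 x = h x + (p x * x n ^ ?j) * f i x" for x
      define g2 where "g2 x = g' x + p x * g i x * x n ^ ?j" for x
      have "h2 \<in> poly_ideal (Suc n) (f ` {..<k})" unfolding h2_def using ideal .
      moreover have "g2 \<in> poly_level n (d k)" unfolding g2_def
        using poly_level_mult[OF g[of i] step.hyps(2), of ?j] dk by (intro poly_level_add h) simp
      moreover have "h2 = (\<lambda>x. g2 x + (b x + p x * s x) * x n ^ d k)"
      proof
        fix x :: "nat \<Rightarrow> 'k"
        have "x n ^ d k = x n ^ d i * x n ^ ?j" by (subst dk) (simp add: power_add)
        then show "h2 x = g2 x + (b x + p x * s x) * x n ^ d k"
          by (simp add: h2_def g2_def h(3) fk i(2) algebra_simps)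
      qed
      ultimately show ?case by (intro bexI[of _ h2] bexI[of _ g2])
    qed
    from this[OF ck] obtain h g' where h: "h \<in> poly_ideal (Suc n) (f ` {..<k})"
      and g': "g' \<in> poly_level n (d k)" and h_eq: "h = (\<lambda>x. g' x + c k x * x n ^ d k)" by blast
    define r where "r = (\<lambda>x. f k x + (- 1) * h x)"
    have "r = (\<lambda>x. g k x + (-1) * g' x * x n ^ 0)" unfolding r_def h_eq fk by (auto simp: algebra_simps)
    then have "r \<in> poly_level n (d k)"
      using poly_level_add[OF g[of k] poly_level_mult[OF g' poly_funs.const[of "-1"], of 0, simplified]] by simp
    moreover have "poly_ideal (Suc n) (f ` {..<k}) \<subseteq> I"
      unfolding I_def by (rule poly_ideal_trans) (use f I_def in auto)
    then have "r \<in> I" unfolding r_def I_def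
      by (intro poly_ideal_add poly_ideal_mult poly_funs.const) (use f[of k] h I_def in auto)
    moreover have "r \<notin> poly_ideal (Suc n) (f ` {..<k})"
    proof
      assume "r \<in> poly_ideal (Suc n) (f ` {..<k})"
      from poly_ideal_add[OF this h] have "f k \<in> poly_ideal (Suc n) (f ` {..<k})"
        by (simp add: r_def)
      then show False using f[of k] by blast
    qed
    ultimately show False using min by blast
  qed
  then obtain T where T: "finite T" "T \<subseteq> I" "I \<subseteq> poly_ideal (Suc n) T" by blast
  obtain T' where T': "finite T'" "T' \<subseteq> S" "T \<subseteq> poly_ideal (Suc n) T'"
    using poly_ideal_finite_support_set[OF T(1) T(2)[unfolded I_def]] by auto
  have "S \<subseteq> I" unfolding I_def by (auto intro: poly_ideal_superset)
  also have "I \<subseteq> poly_ideal (Suc n) T" by (rule T(3))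
  also have "\<dots> \<subseteq> poly_ideal (Suc n) T'" using T'(3) by (rule poly_ideal_trans)
  finally have "S \<subseteq> poly_ideal (Suc n) T'" .
  then show ?case using T' by blast
qed

lemma zero_locus_finite:
  fixes S :: "((nat \<Rightarrow> 'k::field) \<Rightarrow> 'k) set"
  assumes "S \<subseteq> poly_funs n"
  obtains T where "finite T" "T \<subseteq> S" "zero_locus n T = zero_locus n S"
proof -
  obtain T where T: "finite T" "T \<subseteq> S" "S \<subseteq> poly_ideal n T"
    using hilbert_basis[OF assms] by blast
  then have "zero_locus n T = zero_locus n S"
    unfolding zero_locus_def by (auto dest: poly_ideal_vanish)
  with T that show ?thesis by blast
qed

section \<open>Elimination of one quantifier\<close>

text \<open>The quantifier-free predicates in \<open>n\<close> coordinates: Boolean combinations of polynomial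
  equations.  They are predicates on all of \<open>nat \<Rightarrow> 'k\<close>, but depend only on the first
  \<open>n\<close> values of their argument.\<close>

inductive_set qf :: "nat \<Rightarrow> ((nat \<Rightarrow> 'k::field) \<Rightarrow> bool) set" for n :: nat where
  zero: "p \<in> poly_funs n \<Longrightarrow> (\<lambda>x. p x = 0) \<in> qf n"
| neg: "P \<in> qf n \<Longrightarrow> (\<lambda>x. \<not> P x) \<in> qf n"
| conj: "P \<in> qf n \<Longrightarrow> Q \<in> qf n \<Longrightarrow> (\<lambda>x. P x \<and> Q x) \<in> qf n"

lemma qf_disj: "P \<in> qf n \<Longrightarrow> Q \<in> qf n \<Longrightarrow> (\<lambda>x. P x \<or> Q x) \<in> qf n"
  using qf.neg[OF qf.conj[OF qf.neg qf.neg], of P n Q] by simp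

lemma qf_const: "(\<lambda>x. b) \<in> qf n"
  using qf.zero[OF poly_funs.const[of 0]] qf.zero[OF poly_funs.const[of 1]] by (cases b) simp_all

lemma qf_Ball: "finite I \<Longrightarrow> (\<And>i. i \<in> I \<Longrightarrow> P i \<in> qf n) \<Longrightarrow> (\<lambda>x. \<forall>i\<in>I. P i x) \<in> qf n"
proof (induction rule: finite_induct)
  case (insert i I)
  have "(\<lambda>x. P i x \<and> (\<forall>i\<in>I. P i x)) \<in> qf n"
    by (intro qf.conj insert.IH insert.prems) auto
  then show ?case by simp
qed (simp add: qf_const)

lemma qf_Bex:
  assumes "finite I" "\<And>i. i \<in> I \<Longrightarrow> P i \<in> qf n"
  shows "(\<lambda>x. \<exists>i\<in>I. P i x) \<in> qf n"
proof -
  have "(\<lambda>x. \<not> (\<forall>i\<in>I. \<not> P i x)) \<in> qf n"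
    by (intro qf.neg qf_Ball) (use assms in \<open>auto intro: qf.neg\<close>)
  then show ?thesis by simp
qed

text \<open>The piecewise rational functions: on the members of a finite quantifier-free partition they
  are quotients of polynomial functions.  As division by zero yields zero, no condition on the
  denominators is needed, and the class is closed under all field operations, including total
  division.\<close>

inductive_set pw_rational :: "nat \<Rightarrow> ((nat \<Rightarrow> 'k::field) \<Rightarrow> 'k) set" for n :: nat where
  frac: "p \<in> poly_funs n \<Longrightarrow> q \<in> poly_funs n \<Longrightarrow> (\<lambda>x. p x / q x) \<in> pw_rational n"
| ite: "P \<in> qf n \<Longrightarrow> f \<in> pw_rational n \<Longrightarrow> g \<in> pw_rational n \<Longrightarrow>
    (\<lambda>x. if P x then f x else g x) \<in> pw_rational n"

lemma pw_rational_poly: "p \<in> poly_funs n \<Longrightarrow> p \<in> pw_rational n"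
  using pw_rational.frac[OF _ poly_funs.const[of 1], of p n] by simp

lemma pw_rational_const: "(\<lambda>x. c) \<in> pw_rational n"
  by (intro pw_rational_poly poly_funs.const)

lemma pw_rational_add_frac:
  assumes p: "p \<in> poly_funs n" and q: "q \<in> poly_funs n" and g: "g \<in> pw_rational n"
  shows "(\<lambda>x. p x / q x + g x) \<in> pw_rational n"
  using g
proof induction
  case (frac p' q')
  have "(\<lambda>x. if q x = 0 then p' x / q' x else if q' x = 0 then p x / q x
      else (p x * q' x + p' x * q x) / (q x * q' x)) \<in> pw_rational n"
    by (intro pw_rational.ite pw_rational.frac qf.zero poly_funs.add poly_funs.mult p q frac)
  also have "(\<lambda>x. if q x = 0 then p' x / q' x else if q' x = 0 then p x / q x
      else (p x * q' x + p' x * q x) / (q x * q' x)) = (\<lambda>x. p x / q x + p' x / q' x)"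
    by (auto simp: field_simps)
  finally show ?case .
next
  case (ite P f g)
  from pw_rational.ite[OF ite(1) ite.IH] show ?case by (simp add: if_distrib cong: if_cong)
qed

lemma pw_rational_add:
  assumes "f \<in> pw_rational n" "g \<in> pw_rational n"
  shows "(\<lambda>x. f x + g x) \<in> pw_rational n"
  using assms(1)
proof induction
  case (frac p q)
  then show ?case using assms(2) by (rule pw_rational_add_frac)
next
  case (ite P f1 f2)
  have "(\<lambda>x. if P x then f1 x + g x else f2 x + g x) = (\<lambda>x. (if P x then f1 x else f2 x) + g x)"
    by auto
  with pw_rational.ite[OF ite(1) ite.IH] show ?case by simp
qed

lemma pw_rational_mult:
  assumes "f \<in> pw_rational n" "g \<in> pw_rational n"
  shows "(\<lambda>x. f x * g x) \<in> pw_rational n"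
  using assms(1)
proof induction
  case (frac p q)
  from assms(2) show ?case
  proof induction
    case (frac p' q')
    have "(\<lambda>x. (p x * p' x) / (q x * q' x)) \<in> pw_rational n"
      by (intro pw_rational.frac poly_funs.mult frac \<open>p \<in> poly_funs n\<close> \<open>q \<in> poly_funs n\<close>)
    then show ?case by simp
  next
    case (ite P f1 f2)
    have "(\<lambda>x. if P x then p x / q x * f1 x else p x / q x * f2 x) =
        (\<lambda>x. p x / q x * (if P x then f1 x else f2 x))" by auto
    with pw_rational.ite[OF ite(1) ite.IH] show ?case by simp
  qed
next
  case (ite P f1 f2)
  have "(\<lambda>x. if P x then f1 x * g x else f2 x * g x) = (\<lambda>x. (if P x then f1 x else f2 x) * g x)"
    by auto
  with pw_rational.ite[OF ite(1) ite.IH] show ?case by simp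
qed

lemma pw_rational_inverse: "f \<in> pw_rational n \<Longrightarrow> (\<lambda>x. inverse (f x)) \<in> pw_rational n"
proof (induction rule: pw_rational.induct)
  case (frac p q)
  from pw_rational.frac[OF frac(2,1)] show ?case by simp
next
  case (ite P f1 f2)
  have "(\<lambda>x. if P x then inverse (f1 x) else inverse (f2 x)) =
      (\<lambda>x. inverse (if P x then f1 x else f2 x))" by auto
  with pw_rational.ite[OF ite(1) ite.IH] show ?case by simp
qed

lemma pw_rational_divide: "f \<in> pw_rational n \<Longrightarrow> g \<in> pw_rational n \<Longrightarrow> (\<lambda>x. f x / g x) \<in> pw_rational n"
  using pw_rational_mult[OF _ pw_rational_inverse, of f n g] by (simp add: divide_inverse)

lemma pw_rational_diff: "f \<in> pw_rational n \<Longrightarrow> g \<in> pw_rational n \<Longrightarrow> (\<lambda>x. f x - g x) \<in> pw_rational n"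
  using pw_rational_add[OF _ pw_rational_mult[OF pw_rational_const[of "-1"]], of f n g] by simp

lemma pw_rational_sum: "finite I \<Longrightarrow> (\<And>i. i \<in> I \<Longrightarrow> f i \<in> pw_rational n) \<Longrightarrow> (\<lambda>x. \<Sum>i\<in>I. f i x) \<in> pw_rational n"
proof (induction rule: finite_induct)
  case (insert i I)
  have "(\<lambda>x. f i x + (\<Sum>i\<in>I. f i x)) \<in> pw_rational n"
    by (intro pw_rational_add insert.IH insert.prems) auto
  then show ?case using insert.hyps by simp
qed (simp add: pw_rational_const)

lemma qf_pw_rational_zero: "f \<in> pw_rational n \<Longrightarrow> (\<lambda>x. f x = 0) \<in> qf n"
proof (induction rule: pw_rational.induct)
  case (frac p q)
  have "(\<lambda>x. p x = 0 \<or> q x = 0) \<in> qf n" by (intro qf_disj qf.zero frac)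
  then show ?case by simp
next
  case (ite P f1 f2)
  have "(\<lambda>x. (P x \<and> f1 x = 0) \<or> (\<not> P x \<and> f2 x = 0)) \<in> qf n"
    by (intro qf_disj qf.conj qf.neg ite)
  also have "(\<lambda>x. (P x \<and> f1 x = 0) \<or> (\<not> P x \<and> f2 x = 0)) = (\<lambda>x. (if P x then f1 x else f2 x) = 0)"
    by auto
  finally show ?case .
qed

text \<open>A family of polynomials in one variable, parametrised by points of affine \<open>n\<close>-space: the
  coefficients are piecewise rational functions of the parameter and vanish from index \<open>d\<close> on.
  Thus all degrees are less than \<open>d\<close>, and the family is zero if \<open>d = 0\<close>.\<close>

definition poly_fam :: "nat \<Rightarrow> nat \<Rightarrow> ((nat \<Rightarrow> 'k::field) \<Rightarrow> 'k poly) \<Rightarrow> bool" where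
  "poly_fam n d F \<longleftrightarrow>
    (\<forall>x. \<forall>i\<ge>d. coeff (F x) i = 0) \<and> (\<forall>i. (\<lambda>x. coeff (F x) i) \<in> pw_rational n)"

lemma poly_famI:
  assumes "\<And>x i. d \<le> i \<Longrightarrow> coeff (F x) i = 0" "\<And>i. (\<lambda>x. coeff (F x) i) \<in> pw_rational n"
  shows "poly_fam n d F"
  using assms unfolding poly_fam_def by blast

lemma poly_fam_coeff: "poly_fam n d F \<Longrightarrow> (\<lambda>x. coeff (F x) i) \<in> pw_rational n"
  unfolding poly_fam_def by blast

lemma poly_fam_bound: "poly_fam n d F \<Longrightarrow> d \<le> i \<Longrightarrow> coeff (F x) i = 0"
  unfolding poly_fam_def by blast

lemma poly_fam_degree: "poly_fam n d F \<Longrightarrow> degree (F x) \<le> d"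
  by (rule degree_le) (auto intro: poly_fam_bound)

lemma poly_fam_rebound:
  "poly_fam n d F \<Longrightarrow> (\<And>x i. e \<le> i \<Longrightarrow> coeff (F x) i = 0) \<Longrightarrow> poly_fam n e F"
  unfolding poly_fam_def by blast

lemma poly_fam_mono: "poly_fam n d F \<Longrightarrow> d \<le> e \<Longrightarrow> poly_fam n e F"
  by (meson poly_fam_rebound poly_fam_bound order_trans)

lemma poly_fam_0: "poly_fam n d (\<lambda>x. 0)"
  by (rule poly_famI) (simp_all add: pw_rational_const)

lemma poly_fam_monom:
  assumes "f \<in> pw_rational n" shows "poly_fam n (Suc k) (\<lambda>x. monom (f x) k)"
proof (rule poly_famI)
  show "(\<lambda>x. coeff (monom (f x) k) i) \<in> pw_rational n" for i
    by (cases "i = k") (simp_all add: assms pw_rational_const)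
qed auto

lemma poly_fam_add:
  assumes "poly_fam n d F" "poly_fam n e G"
  shows "poly_fam n (max d e) (\<lambda>x. F x + G x)"
proof (rule poly_famI)
  show "coeff (F x + G x) i = 0" if "max d e \<le> i" for x i
    using that poly_fam_bound[OF assms(1), of i x] poly_fam_bound[OF assms(2), of i x] by simp
  show "(\<lambda>x. coeff (F x + G x) i) \<in> pw_rational n" for i
    using pw_rational_add[OF assms[THEN poly_fam_coeff]] by simp
qed

lemma poly_fam_diff:
  assumes "poly_fam n d F" "poly_fam n e G"
  shows "poly_fam n (max d e) (\<lambda>x. F x - G x)"
proof (rule poly_famI)
  show "coeff (F x - G x) i = 0" if "max d e \<le> i" for x i
    using that poly_fam_bound[OF assms(1), of i x] poly_fam_bound[OF assms(2), of i x] by simp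
  show "(\<lambda>x. coeff (F x - G x) i) \<in> pw_rational n" for i
    using pw_rational_diff[OF assms[THEN poly_fam_coeff]] by simp
qed

lemma poly_fam_mult:
  assumes "poly_fam n d F" "poly_fam n e G"
  shows "poly_fam n (d + e) (\<lambda>x. F x * G x)"
proof (rule poly_famI)
  show "coeff (F x * G x) i = 0" if "d + e \<le> i" for x i
    unfolding coeff_mult
  proof (rule sum.neutral, rule ballI)
    fix j assume "j \<in> {..i}"
    have "d \<le> j \<or> e \<le> i - j" using that by auto
    then show "coeff (F x) j * coeff (G x) (i - j) = 0"
      using poly_fam_bound[OF assms(1)] poly_fam_bound[OF assms(2)] by auto
  qed
  show "(\<lambda>x. coeff (F x * G x) i) \<in> pw_rational n" for i
    unfolding coeff_mult by (intro pw_rational_sum pw_rational_mult assms[THEN poly_fam_coeff] finite_atMost)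
qed

lemma poly_fam_power:
  assumes "poly_fam n d F" shows "\<exists>e. poly_fam n e (\<lambda>x. F x ^ k)"
proof (induction k)
  case 0
  show ?case using poly_fam_monom[OF pw_rational_const[of 1], of n 0] by (auto simp: monom_eq_1)
next
  case (Suc k)
  then show ?case using poly_fam_mult[OF assms] by fastforce
qed

lemma poly_fam_ite:
  assumes "P \<in> qf n" "poly_fam n d F" "poly_fam n d G"
  shows "poly_fam n d (\<lambda>x. if P x then F x else G x)"
proof (rule poly_famI)
  show "coeff (if P x then F x else G x) i = 0" if "d \<le> i" for x i
    using assms(2,3) that by (simp add: poly_fam_bound)
  show "(\<lambda>x. coeff (if P x then F x else G x) i) \<in> pw_rational n" for i
    using pw_rational.ite[OF assms(1) assms(2,3)[THEN poly_fam_coeff], of i i]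
    by (simp add: if_distrib[of "\<lambda>p. coeff p i"])
qed

text \<open>Division with remainder in families proceeds by distinguishing whether the coefficient of
  \<open>G\<close> at its highest possible index \<open>e\<close> vanishes.  Where it does, \<open>G\<close> belongs to a
  family with a smaller bound; where it does not, the degree of \<open>G\<close> is \<open>e\<close> and the usual
  algorithm works.  In each case the family is set to zero at the other parameters, so that its
  bound holds everywhere.\<close>

lemma poly_fam_truncate:
  assumes "poly_fam n (Suc e) G"
  shows "poly_fam n e (\<lambda>x. if coeff (G x) e = 0 then G x else 0)"
proof (rule poly_fam_rebound)
  show "poly_fam n (Suc e) (\<lambda>x. if coeff (G x) e = 0 then G x else 0)"
    by (intro poly_fam_ite qf_pw_rational_zero poly_fam_coeff[OF assms] assms poly_fam_0)
  show "coeff (if coeff (G x) e = 0 then G x else 0) i = 0" if "e \<le> i" for x i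
    using that poly_fam_bound[OF assms, of i x] by (cases "i = e") auto
qed

lemma poly_fam_remainder_full:
  assumes G: "poly_fam n (Suc e) G" and F: "poly_fam n d F"
  shows "poly_fam n d (\<lambda>x. if coeff (G x) e = 0 then 0 else F x mod G x)"
  using F
proof (induction d arbitrary: F)
  case 0
  have "F x = 0" for x by (rule poly_eqI) (simp add: poly_fam_bound[OF 0])
  then show ?case using poly_fam_0 by (simp cong: if_cong)
next
  case (Suc d)
  have degG: "degree (G x) = e" if "coeff (G x) e \<noteq> 0" for x
    using that poly_fam_bound[OF G] by (intro antisym degree_le le_degree) auto
  have qf: "(\<lambda>x. coeff (G x) e = 0) \<in> qf n"
    by (intro qf_pw_rational_zero poly_fam_coeff[OF G])
  show ?case
  proof (cases "d < e")
    case True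
    have "F x mod G x = F x" if "coeff (G x) e \<noteq> 0" for x
    proof (rule mod_poly_less)
      have "degree (F x) \<le> d" using poly_fam_bound[OF Suc.prems] by (intro degree_le) auto
      then show "degree (F x) < degree (G x)" using degG[OF that] True by simp
    qed
    then have "(\<lambda>x. if coeff (G x) e = 0 then 0 else F x mod G x) =
        (\<lambda>x. if coeff (G x) e = 0 then 0 else F x)" by auto
    then show ?thesis using poly_fam_ite[OF qf poly_fam_0 Suc.prems] by simp
  next
    case not_less: False
    \<comment> \<open>one step of long division: \<open>M\<close> is the leading term of the quotient\<close>
    define M where "M x = monom (coeff (F x) d / coeff (G x) e) (d - e)" for x
    define F1 where "F1 x = (if coeff (G x) e = 0 then 0 else F x - M x * G x)" for x
    have "poly_fam n (Suc (d - e)) M" unfolding M_def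
      by (intro poly_fam_monom pw_rational_divide poly_fam_coeff[OF G] poly_fam_coeff[OF Suc.prems])
    from poly_fam_diff[OF Suc.prems poly_fam_mult[OF this G]]
    have "poly_fam n (max (Suc d) (Suc (d - e) + Suc e)) F1" unfolding F1_def
      by (intro poly_fam_ite qf poly_fam_0)
    then have "poly_fam n d F1"
    proof (rule poly_fam_rebound)
      fix x i assume i: "d \<le> i"
      show "coeff (F1 x) i = 0"
      proof (cases "i = d")
        case True
        then show ?thesis using not_less by (simp add: F1_def M_def coeff_monom_mult)
      next
        case False
        then have "coeff (F x) i = 0" "coeff (G x) (i - (d - e)) = 0"
          using i not_less poly_fam_bound[OF Suc.prems] poly_fam_bound[OF G] by auto
        then show ?thesis by (simp add: F1_def M_def coeff_monom_mult)
      qed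
    qed
    from poly_fam_mono[OF Suc.IH[OF this], of "Suc d"]
    have "poly_fam n (Suc d) (\<lambda>x. if coeff (G x) e = 0 then 0 else F1 x mod G x)" by simp
    moreover have "F1 x mod G x = F x mod G x" if "coeff (G x) e \<noteq> 0" for x
    proof -
      have "F x = F1 x + M x * G x" using that by (simp add: F1_def)
      then show ?thesis by (metis mod_mult_self1)
    qed
    then have "(\<lambda>x. if coeff (G x) e = 0 then 0 else F1 x mod G x) =
        (\<lambda>x. if coeff (G x) e = 0 then 0 else F x mod G x)" by auto
    ultimately show ?thesis by simp
  qed
qed

lemma poly_fam_remainder_bound:
  assumes G: "poly_fam n (Suc e) G" and F: "poly_fam n d F"
  shows "poly_fam n e (\<lambda>x. if coeff (G x) e = 0 then 0 else F x mod G x)"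
proof (rule poly_fam_rebound[OF poly_fam_remainder_full[OF assms]])
  fix x i assume i: "e \<le> i"
  show "coeff (if coeff (G x) e = 0 then 0 else F x mod G x) i = 0"
  proof (cases "coeff (G x) e = 0")
    case False
    then have "G x \<noteq> 0" "degree (G x) \<le> e"
      using poly_fam_bound[OF G] by (auto intro!: degree_le)
    then have "F x mod G x = 0 \<or> degree (F x mod G x) < i"
      using degree_mod_less[of "G x" "F x"] i by auto
    then show ?thesis by (auto intro: coeff_eq_0)
  qed simp
qed

lemma poly_fam_mod:
  assumes "poly_fam n e G" "poly_fam n d F"
  shows "poly_fam n d (\<lambda>x. F x mod G x)"
  using assms(1)
proof (induction e arbitrary: G)
  case 0
  have "G x = 0" for x by (rule poly_eqI) (simp add: poly_fam_bound[OF 0])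
  then show ?case using assms(2) by simp
next
  case (Suc e)
  have "poly_fam n d (\<lambda>x. if coeff (G x) e = 0
      then F x mod (if coeff (G x) e = 0 then G x else 0)
      else (if coeff (G x) e = 0 then 0 else F x mod G x))"
    by (intro poly_fam_ite qf_pw_rational_zero poly_fam_coeff[OF Suc.prems] Suc.IH
        poly_fam_truncate[OF Suc.prems] poly_fam_remainder_full[OF Suc.prems assms(2)])
  then show ?case by (simp cong: if_cong)
qed

text \<open>Euclid's algorithm in families: two equations in the last variable can be replaced by one.\<close>

lemma poly_fam_common_roots:
  assumes "poly_fam n d F" "poly_fam n e G"
  shows "\<exists>d' H. poly_fam n d' H \<and>
    (\<forall>x t. poly (H x) t = 0 \<longleftrightarrow> poly (F x) t = 0 \<and> poly (G x) t = 0)"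
  using assms
proof (induction e arbitrary: d F G)
  case 0
  have "G x = 0" for x by (rule poly_eqI) (simp add: poly_fam_bound[OF 0(2)])
  then show ?case using 0(1) by auto
next
  case (Suc e)
  let ?G = "\<lambda>x. if coeff (G x) e = 0 then G x else 0"
  let ?R = "\<lambda>x. if coeff (G x) e = 0 then 0 else F x mod G x"
  obtain d1 H1 where H1: "poly_fam n d1 H1"
    "\<And>x t. poly (H1 x) t = 0 \<longleftrightarrow> poly (F x) t = 0 \<and> poly (?G x) t = 0"
    using Suc.IH[OF Suc.prems(1) poly_fam_truncate[OF Suc.prems(2)]] by blast
  obtain d2 H2 where H2: "poly_fam n d2 H2"
    "\<And>x t. poly (H2 x) t = 0 \<longleftrightarrow> poly (G x) t = 0 \<and> poly (?R x) t = 0"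
    using Suc.IH[OF Suc.prems(2) poly_fam_remainder_bound[OF Suc.prems(2,1)]] by blast
  let ?H = "\<lambda>x. if coeff (G x) e = 0 then H1 x else H2 x"
  have "poly_fam n (max d1 d2) ?H"
    by (intro poly_fam_ite qf_pw_rational_zero poly_fam_coeff[OF Suc.prems(2)]
        poly_fam_mono[OF H1(1)] poly_fam_mono[OF H2(1)]) auto
  moreover have "poly (?H x) t = 0 \<longleftrightarrow> poly (F x) t = 0 \<and> poly (G x) t = 0" for x t
  proof (cases "coeff (G x) e = 0")
    case True
    then show ?thesis using H1(2)[of x t] by simp
  next
    case False
    have "poly (F x) t = poly (F x div G x) t * poly (G x) t + poly (F x mod G x) t"
      by (metis div_mult_mod_eq poly_add poly_mult)
    then show ?thesis using False H2(2)[of x t] by auto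
  qed
  ultimately show ?case by blast
qed

lemma qf_poly_fam_zero:
  assumes "poly_fam n d F" shows "(\<lambda>x. F x = 0) \<in> qf n"
proof -
  have "F x = 0 \<longleftrightarrow> (\<forall>i\<in>{..<d}. coeff (F x) i = 0)" for x
    using poly_fam_bound[OF assms] by (metis coeff_0 lessThan_iff not_less poly_eqI)
  moreover have "(\<lambda>x. \<forall>i\<in>{..<d}. coeff (F x) i = 0) \<in> qf n"
    by (intro qf_Ball qf_pw_rational_zero poly_fam_coeff[OF assms] finite_lessThan)
  ultimately show ?thesis by simp
qed

lemma poly_funs_Suc_fam:
  assumes "p \<in> poly_funs (Suc n)"
  shows "\<exists>d F. poly_fam n d F \<and> (\<forall>x t. p (x(n := t)) = poly (F x) t)"
  using assms
proof induction
  case (const c)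
  have "poly_fam n (Suc 0) (\<lambda>x. monom c 0)" by (intro poly_fam_monom pw_rational_const)
  then show ?case by (intro exI conjI) (assumption, simp add: poly_monom)
next
  case (coord i)
  show ?case
  proof (cases "i = n")
    case True
    have "poly_fam n (Suc 1) (\<lambda>x. monom 1 1)" by (intro poly_fam_monom pw_rational_const)
    then show ?thesis using True by (intro exI conjI) (assumption, simp add: poly_monom)
  next
    case False
    have "poly_fam n (Suc 0) (\<lambda>x. monom (x i) 0)"
      using coord False by (intro poly_fam_monom pw_rational_poly poly_funs.coord) auto
    then show ?thesis using False by (intro exI conjI) (assumption, simp add: poly_monom)
  qed
next
  case (add p q)
  then obtain d F e G where "poly_fam n d F" "\<forall>x t. p (x(n := t)) = poly (F x) t"
    "poly_fam n e G" "\<forall>x t. q (x(n := t)) = poly (G x) t" by blast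
  then show ?case
    by (intro exI[of _ "max d e"] exI[of _ "\<lambda>x. F x + G x"]) (simp add: poly_fam_add del: fun_upd_apply)
next
  case (mult p q)
  then obtain d F e G where "poly_fam n d F" "\<forall>x t. p (x(n := t)) = poly (F x) t"
    "poly_fam n e G" "\<forall>x t. q (x(n := t)) = poly (G x) t" by blast
  then show ?case
    by (intro exI[of _ "d + e"] exI[of _ "\<lambda>x. F x * G x"]) (simp add: poly_fam_mult del: fun_upd_apply)
qed

text \<open>The predicates on a parameter \<open>x\<close> and a point \<open>t\<close> of the line that are finite
  disjunctions of conditions \<open>F x t = 0 \<and> G x t \<noteq> 0\<close>.  This is the normal form to which
  quantifier-free predicates are brought before the quantifier over \<open>t\<close> is eliminated.\<close>

inductive_set line_preds :: "nat \<Rightarrow> ((nat \<Rightarrow> 'k::field) \<Rightarrow> 'k \<Rightarrow> bool) set" for n :: nat where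
  basic: "poly_fam n d F \<Longrightarrow> poly_fam n e G \<Longrightarrow>
    (\<lambda>x t. poly (F x) t = 0 \<and> poly (G x) t \<noteq> 0) \<in> line_preds n"
| disj: "P \<in> line_preds n \<Longrightarrow> Q \<in> line_preds n \<Longrightarrow> (\<lambda>x t. P x t \<or> Q x t) \<in> line_preds n"

lemma line_preds_conj:
  assumes "P \<in> line_preds n" "Q \<in> line_preds n"
  shows "(\<lambda>x t. P x t \<and> Q x t) \<in> line_preds n"
  using assms(1)
proof induction
  case (basic d F e G)
  from assms(2) show ?case
  proof induction
    case (basic d' F' e' G')
    obtain d'' H where H: "poly_fam n d'' H"
      "\<And>x t. poly (H x) t = 0 \<longleftrightarrow> poly (F x) t = 0 \<and> poly (F' x) t = 0"
      using poly_fam_common_roots[OF \<open>poly_fam n d F\<close> basic(1)] by blast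
    have "(\<lambda>x t. poly (H x) t = 0 \<and> poly (G x * G' x) t \<noteq> 0) \<in> line_preds n"
      by (rule line_preds.basic[OF H(1) poly_fam_mult[OF \<open>poly_fam n e G\<close> basic(2)]])
    also have "(\<lambda>x t. poly (H x) t = 0 \<and> poly (G x * G' x) t \<noteq> 0) =
      (\<lambda>x t. (poly (F x) t = 0 \<and> poly (G x) t \<noteq> 0) \<and> (poly (F' x) t = 0 \<and> poly (G' x) t \<noteq> 0))"
      by (auto simp: H(2) fun_eq_iff)
    finally show ?case .
  next
    case (disj P Q)
    from line_preds.disj[OF disj.IH] show ?case by (simp add: conj_disj_distribL)
  qed
next
  case (disj P R)
  from line_preds.disj[OF disj.IH] show ?case by (simp add: conj_disj_distribR)
qed

lemma line_preds_neg: "P \<in> line_preds n \<Longrightarrow> (\<lambda>x t. \<not> P x t) \<in> line_preds n"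
proof (induction rule: line_preds.induct)
  case (basic d F e G)
  have one: "poly_fam n (Suc 0) (\<lambda>x. monom 1 0)" by (intro poly_fam_monom pw_rational_const)
  have "(\<lambda>x t. (poly ((\<lambda>x. 0) x) t = 0 \<and> poly (F x) t \<noteq> 0) \<or>
      (poly (G x) t = 0 \<and> poly ((\<lambda>x. monom 1 0) x) t \<noteq> 0)) \<in> line_preds n"
    by (rule line_preds.disj[OF line_preds.basic[OF poly_fam_0 basic(1)] line_preds.basic[OF basic(2) one]])
  also have "(\<lambda>x t. (poly ((\<lambda>x. 0) x) t = 0 \<and> poly (F x) t \<noteq> 0) \<or>
      (poly (G x) t = 0 \<and> poly ((\<lambda>x. monom 1 0) x) t \<noteq> 0)) =
      (\<lambda>x t. \<not> (poly (F x) t = 0 \<and> poly (G x) t \<noteq> 0))"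
    by (auto simp: fun_eq_iff poly_monom)
  finally show ?case .
next
  case (disj P Q)
  from line_preds_conj[OF disj.IH] show ?case by simp
qed

text \<open>The quantified variable is the last of \<open>n + 1\<close> coordinates, at index \<open>n\<close>.\<close>

lemma qf_line_preds: "P \<in> qf (Suc n) \<Longrightarrow> (\<lambda>x t. P (x(n := t))) \<in> line_preds n"
proof (induction rule: qf.induct)
  case (zero p)
  obtain d F where F: "poly_fam n d F" "\<And>x t. p (x(n := t)) = poly (F x) t"
    using poly_funs_Suc_fam[OF zero] by blast
  have one: "poly_fam n (Suc 0) (\<lambda>x. monom 1 0)" by (intro poly_fam_monom pw_rational_const)
  from line_preds.basic[OF F(1) one]
  show ?case by (simp add: F(2) poly_monom del: fun_upd_apply)
qed (simp_all add: line_preds_conj line_preds_neg)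

lemma infinite_alg_closed: "infinite (UNIV :: 'k::alg_closed_field set)"
proof
  assume fin: "finite (UNIV :: 'k set)"
  \<comment> \<open>If there were only finitely many elements, this polynomial would take the value 1 everywhere.\<close>
  let ?p = "(\<Prod>a\<in>(UNIV::'k set). [:- a, 1:]) + 1"
  have "degree (\<Prod>a\<in>(UNIV::'k set). [:- a, 1:]) = card (UNIV :: 'k set)"
    by (subst degree_prod_eq_sum_degree) auto
  also have "\<dots> > 0" using fin by (simp add: card_gt_0_iff)
  finally have "degree ?p > 0" by (subst degree_add_eq_left) auto
  then obtain z where "poly ?p z = 0" using alg_closed_imp_poly_has_root by blast
  moreover have "(\<Prod>a\<in>(UNIV::'k set). z - a) = 0"
    using fin by (intro prod_zero bexI[of _ z]) auto
  ultimately show False by (simp add: poly_prod)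
qed

lemma roots_subset_imp_dvd_power:
  fixes F G :: "'k::alg_closed_field poly"
  assumes "F \<noteq> 0" "degree F \<le> d" "\<And>t. poly F t = 0 \<Longrightarrow> poly G t = 0"
  shows "F dvd G ^ d"
  using assms
proof (induction d arbitrary: F)
  case 0
  then show ?case by (simp add: is_unit_iff_degree)
next
  case (Suc d)
  show ?case
  proof (cases "degree F = 0")
    case True
    then have "F dvd 1" using Suc.prems by (simp add: is_unit_iff_degree)
    then show ?thesis using dvd_trans one_dvd by blast
  next
    case False
    then obtain a where a: "poly F a = 0" using alg_closed_imp_poly_has_root by blast
    then obtain F' where F': "F = [:- a, 1:] * F'" by (auto simp: poly_eq_0_iff_dvd)
    have "F' \<noteq> 0" using F' Suc.prems(1) by auto
    moreover from this have "degree F = Suc (degree F')" unfolding F' by (subst degree_mult_eq) auto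
    then have "degree F' \<le> d" using Suc.prems(2) by simp
    moreover have "poly G t = 0" if "poly F' t = 0" for t
      using Suc.prems(3)[of t] that F' by simp
    ultimately have "F' dvd G ^ d" by (rule Suc.IH)
    moreover have "[:- a, 1:] dvd G" using Suc.prems(3)[OF a] by (simp add: poly_eq_0_iff_dvd)
    ultimately show ?thesis unfolding F' power_Suc by (intro mult_dvd_mono)
  qed
qed

text \<open>The existence of a common solution of an equation and an inequation is a divisibility, and
  thereby the non-vanishing of a remainder.  The exponent is positive so that the equivalence also
  holds for \<open>F = 0\<close>, where it uses that the field is infinite.\<close>

lemma ex_root_not_root_iff:
  fixes F G :: "'k::alg_closed_field poly"
  assumes "degree F \<le> d"
  shows "(\<exists>t. poly F t = 0 \<and> poly G t \<noteq> 0) \<longleftrightarrow> \<not> F dvd G ^ Suc d"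
proof (cases "F = 0")
  case True
  have "(\<exists>t. poly G t \<noteq> 0) \<longleftrightarrow> G \<noteq> 0"
    using poly_roots_finite[of G] infinite_alg_closed by (metis (mono_tags, lifting) Collect_cong UNIV_def poly_0)
  then show ?thesis using True by auto
next
  case False
  have "poly G t = 0" if dvd: "F dvd G ^ Suc d" and root: "poly F t = 0" for t
  proof -
    obtain K where "G ^ Suc d = F * K" using dvd by (elim dvdE)
    then have "poly (G ^ Suc d) t = 0" using root by (simp del: power_Suc)
    then show ?thesis by auto
  qed
  moreover have "F dvd G ^ Suc d" if "\<And>t. poly F t = 0 \<Longrightarrow> poly G t = 0"
    using roots_subset_imp_dvd_power[OF False, of "Suc d" G] assms that by simp
  ultimately show ?thesis by blast
qed

lemma line_preds_ex:
  fixes P :: "(nat \<Rightarrow> 'k::alg_closed_field) \<Rightarrow> 'k \<Rightarrow> bool"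
  shows "P \<in> line_preds n \<Longrightarrow> (\<lambda>x. \<exists>t. P x t) \<in> qf n"
proof (induction rule: line_preds.induct)
  case (basic d F e G)
  obtain e' where "poly_fam n e' (\<lambda>x. G x ^ Suc d)" using poly_fam_power[OF basic(2)] by blast
  from poly_fam_mod[OF basic(1) this] have "(\<lambda>x. \<not> G x ^ Suc d mod F x = 0) \<in> qf n"
    by (intro qf.neg qf_poly_fam_zero)
  then show ?case
    by (simp only: ex_root_not_root_iff[OF poly_fam_degree[OF basic(1)]] dvd_eq_mod_eq_0)
next
  case (disj P Q)
  from qf_disj[OF disj.IH] show ?case by (simp add: ex_disj_distrib)
qed

text \<open>A set \<open>{t. F t = 0 \<and> G t \<noteq> 0}\<close> with \<open>F = 0\<close> is empty or has a finite complement, and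
  otherwise it has at most as many elements as the degree of \<open>F\<close>.\<close>

lemma line_preds_bounded:
  fixes P :: "(nat \<Rightarrow> 'k::alg_closed_field) \<Rightarrow> 'k \<Rightarrow> bool"
  shows "P \<in> line_preds n \<Longrightarrow> \<exists>N. \<forall>x. finite {t. P x t} \<longrightarrow> card {t. P x t} \<le> N"
proof (induction rule: line_preds.induct)
  case (basic d F e G)
  have "card {t. poly (F x) t = 0 \<and> poly (G x) t \<noteq> 0} \<le> d"
    if fin: "finite {t. poly (F x) t = 0 \<and> poly (G x) t \<noteq> 0}" for x
  proof (cases "F x = 0")
    case True
    have "G x = 0"
    proof (rule ccontr)
      assume "G x \<noteq> 0"
      then have "finite ({t. poly (G x) t = 0} \<union> {t. poly (G x) t \<noteq> 0})"
        using poly_roots_finite fin True by simp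
      then have "finite (UNIV :: 'k set)" by (rule rev_finite_subset) auto
      then show False using infinite_alg_closed by blast
    qed
    then show ?thesis by simp
  next
    case False
    have "card {t. poly (F x) t = 0 \<and> poly (G x) t \<noteq> 0} \<le> card {t. poly (F x) t = 0}"
      using poly_roots_finite[OF False] by (intro card_mono) auto
    also have "\<dots> \<le> degree (F x)" using False by (rule card_poly_roots_bound)
    also have "\<dots> \<le> d" by (rule poly_fam_degree[OF basic(1)])
    finally show ?thesis .
  qed
  then show ?case by blast
next
  case (disj P Q)
  then obtain M N where M: "\<And>x. finite {t. P x t} \<Longrightarrow> card {t. P x t} \<le> M"
    and N: "\<And>x. finite {t. Q x t} \<Longrightarrow> card {t. Q x t} \<le> N" by blast
  have "card {t. P x t \<or> Q x t} \<le> M + N" if "finite {t. P x t \<or> Q x t}" for x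
    using that card_Un_le[of "{t. P x t}" "{t. Q x t}"] M[of x] N[of x]
    by (simp add: Collect_disj_eq)
  then show ?case by blast
qed

lemma qf_ex:
  fixes P :: "(nat \<Rightarrow> 'k::alg_closed_field) \<Rightarrow> bool"
  assumes "P \<in> qf (Suc n)" shows "(\<lambda>x. \<exists>t. P (x(n := t))) \<in> qf n"
  by (rule line_preds_ex[OF qf_line_preds[OF assms]])

lemma qf_bounded:
  fixes P :: "(nat \<Rightarrow> 'k::alg_closed_field) \<Rightarrow> bool"
  assumes "P \<in> qf (Suc n)"
  shows "\<exists>N. \<forall>x. finite {t. P (x(n := t))} \<longrightarrow> card {t. P (x(n := t))} \<le> N"
  by (rule line_preds_bounded[OF qf_line_preds[OF assms]])

section \<open>Slices of quantifier-free sets and their cardinalities\<close>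

lemma poly_funs_subst:
  assumes "p \<in> poly_funs N" "\<And>i. i < N \<Longrightarrow> r i \<in> poly_funs M"
  shows "(\<lambda>x. p (\<lambda>i. r i x)) \<in> poly_funs M"
  using assms(1)
proof induction
  case (coord i)
  then show ?case using assms(2) by simp
qed (simp_all add: poly_funs.const poly_funs.add poly_funs.mult)

lemma qf_subst:
  assumes "P \<in> qf N" "\<And>i. i < N \<Longrightarrow> r i \<in> poly_funs M"
  shows "(\<lambda>x. P (\<lambda>i. r i x)) \<in> qf M"
  using assms(1)
proof induction
  case (zero p)
  then show ?case using assms(2) by (intro qf.zero poly_funs_subst[of p N r M])
qed (simp_all add: qf.neg qf.conj)

lemma qf_rename:
  assumes "P \<in> qf N" "\<And>i. i < N \<Longrightarrow> \<sigma> i < M"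
  shows "(\<lambda>x. P (\<lambda>i. x (\<sigma> i))) \<in> qf M"
  by (rule qf_subst[OF assms(1)]) (rule poly_funs.coord[OF assms(2)])

lemma qf_eq_coord: "i < n \<Longrightarrow> j < n \<Longrightarrow> (\<lambda>x. x i = x j) \<in> qf n"
  using qf.zero[OF poly_funs.add[OF poly_funs.coord poly_funs_minus[OF poly_funs.coord]], of i n j]
  by simp

lemma poly_funs_local:
  assumes "p \<in> poly_funs n" "\<And>i. i < n \<Longrightarrow> x i = y i" shows "p x = p y"
  using assms by induction simp_all

lemma qf_local:
  assumes "P \<in> qf n" "\<And>i. i < n \<Longrightarrow> x i = y i" shows "P x \<longleftrightarrow> P y"
  using assms(1)
proof induction
  case (zero p)
  then show ?case using poly_funs_local[of p n x y] assms(2) by simp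
qed simp_all

text \<open>The point whose first \<open>n\<close> coordinates are those of \<open>y\<close>, followed by those of
  \<open>z\<close>.\<close>

definition join :: "nat \<Rightarrow> (nat \<Rightarrow> 'k) \<Rightarrow> (nat \<Rightarrow> 'k) \<Rightarrow> nat \<Rightarrow> 'k" where
  "join n y z = (\<lambda>i. if i < n then y i else z (i - n))"

lemma qf_join_cong:
  assumes "P \<in> qf (n + m)" "\<And>i. i < m \<Longrightarrow> z i = z' i"
  shows "P (join n y z) \<longleftrightarrow> P (join n y z')"
  by (rule qf_local[OF assms(1)]) (simp add: join_def assms(2))

theorem qf_ex_many:
  fixes P :: "(nat \<Rightarrow> 'k::alg_closed_field) \<Rightarrow> bool"
  assumes "P \<in> qf (n + m)"
  shows "(\<lambda>y. \<exists>z. P (join n y z)) \<in> qf n"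
  using assms
proof (induction m arbitrary: P)
  case 0
  then have P: "P \<in> qf n" by simp
  have "P (join n y z) \<longleftrightarrow> P y" for y z
    by (rule qf_local[OF P]) (simp add: join_def)
  then show ?case using P by simp
next
  case (Suc m)
  have "(\<lambda>x. \<exists>t. P (x(n + m := t))) \<in> qf (n + m)"
    using Suc.prems by (intro qf_ex) simp
  from Suc.IH[OF this] have "(\<lambda>y. \<exists>z t. P ((join n y z)(n + m := t))) \<in> qf n" .
  moreover have "(\<exists>z t. P ((join n y z)(n + m := t))) \<longleftrightarrow> (\<exists>z. P (join n y z))" for y
  proof
    assume "\<exists>z t. P ((join n y z)(n + m := t))"
    then obtain z t where "P ((join n y z)(n + m := t))" by blast
    also have "(join n y z)(n + m := t) = join n y (z(m := t))"
      by (auto simp: join_def fun_eq_iff)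
    finally show "\<exists>z. P (join n y z)" by blast
  next
    assume "\<exists>z. P (join n y z)"
    then obtain z where "P (join n y z)" ..
    then have "P ((join n y z)(n + m := join n y z (n + m)))" by simp
    then show "\<exists>z t. P ((join n y z)(n + m := t))" by blast
  qed
  ultimately show ?case by simp
qed

text \<open>The fibre over \<open>y\<close> of the set defined by \<open>P\<close> in the product of affine \<open>n\<close>-space
  and affine \<open>m\<close>-space, projected to the second factor.  It consists of extensional functions,
  so that different elements differ in one of the first \<open>m\<close> coordinates.\<close>

definition slice :: "nat \<Rightarrow> nat \<Rightarrow> ((nat \<Rightarrow> 'k) \<Rightarrow> bool) \<Rightarrow> (nat \<Rightarrow> 'k) \<Rightarrow> (nat \<Rightarrow> 'k) set" where
  "slice n m P y = {x \<in> affine_space m. P (join n y x)}"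

lemma restrict_in_slice:
  assumes "P \<in> qf (n + m)" "P (join n y z)"
  shows "restrict z {..<m} \<in> slice n m P y"
  using assms(2) qf_join_cong[OF assms(1), of z "restrict z {..<m}" y]
  by (auto simp: slice_def affine_space_def)

lemma ecard_ge_iff:
  "enat j \<le> ecard S \<longleftrightarrow> (\<exists>f. inj_on f {..<j} \<and> f ` {..<j} \<subseteq> S)"
proof
  assume j: "enat j \<le> ecard S"
  obtain T where T: "T \<subseteq> S" "finite T" "card T = j"
  proof (cases "finite S")
    case True
    then have "j \<le> card S" using j by (simp add: ecard_def)
    then show ?thesis using that by (meson obtain_subset_with_card_n)
  next
    case False
    then show ?thesis using that infinite_arbitrarily_large by blast
  qed
  then obtain f where "bij_betw f {..<j} T"
    using ex_bij_betw_nat_finite[OF T(2)] by (auto simp: lessThan_atLeast0)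
  then show "\<exists>f. inj_on f {..<j} \<and> f ` {..<j} \<subseteq> S"
    using T(1) unfolding bij_betw_def by blast
next
  assume "\<exists>f. inj_on f {..<j} \<and> f ` {..<j} \<subseteq> S"
  then show "enat j \<le> ecard S"
    using card_inj_on_le[of _ "{..<j}" S] by (auto simp: ecard_def)
qed

lemma block_index_less:
  fixes a j :: nat assumes "a < j" "i < n + m" shows "a * m + i < n + j * m"
proof -
  have "Suc a * m \<le> j * m" using assms(1) by (intro mult_le_mono1) simp
  then show ?thesis using assms(2) by simp
qed

text \<open>A list of \<open>j\<close> points of affine \<open>m\<close>-space is encoded by \<open>j * m\<close> coordinates, the
  coordinate \<open>i\<close> of the point number \<open>a\<close> being at index \<open>a * m + i\<close>.\<close>

theorem qf_slice_card_ge: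
  fixes P :: "(nat \<Rightarrow> 'k::alg_closed_field) \<Rightarrow> bool"
  assumes P: "P \<in> qf (n + m)"
  shows "(\<lambda>y. enat j \<le> ecard (slice n m P y)) \<in> qf n"
proof -
  \<comment> \<open>\<open>\<sigma> a\<close> selects \<open>y\<close> and the point number \<open>a\<close>.\<close>
  define \<sigma> where "\<sigma> a i = (if i < n then i else n + (a * m + (i - n)))" for a i
  define R where "R w \<longleftrightarrow> (\<forall>a\<in>{..<j}. P (\<lambda>i. w (\<sigma> a i))) \<and>
    (\<forall>a\<in>{..<j}. \<forall>b\<in>{..<j}. a = b \<or> (\<exists>i\<in>{..<m}. \<not> w (n + (a * m + i)) = w (n + (b * m + i))))"
    for w :: "nat \<Rightarrow> 'k"
  have "R \<in> qf (n + j * m)"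
    unfolding R_def
    by (intro qf.conj qf_Ball qf_disj qf_Bex qf_const qf.neg qf_rename[OF P] qf_eq_coord finite_lessThan)
      (auto simp: \<sigma>_def intro: block_index_less block_index_less[where n = 0, simplified])
  then have "(\<lambda>y. \<exists>z. R (join n y z)) \<in> qf n" by (rule qf_ex_many)
  moreover have "(\<exists>z. R (join n y z)) \<longleftrightarrow> enat j \<le> ecard (slice n m P y)" for y
  proof -
    have P_eq: "P (\<lambda>i. join n y z (\<sigma> a i)) \<longleftrightarrow> P (join n y (\<lambda>k. z (a * m + k)))" for z a
      by (rule arg_cong[of _ _ P]) (auto simp: join_def \<sigma>_def)
    have R_eq: "R (join n y z) \<longleftrightarrow> (\<forall>a<j. P (join n y (\<lambda>k. z (a * m + k)))) \<and>
      (\<forall>a<j. \<forall>b<j. a = b \<or> (\<exists>i<m. z (a * m + i) \<noteq> z (b * m + i)))" for z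
      unfolding R_def P_eq by (auto simp: join_def)
    show ?thesis unfolding ecard_ge_iff
    proof
      assume "\<exists>z. R (join n y z)"
      then obtain z where z1: "\<And>a. a < j \<Longrightarrow> P (join n y (\<lambda>k. z (a * m + k)))"
        and z2: "\<And>a b. a < j \<Longrightarrow> b < j \<Longrightarrow> a \<noteq> b \<Longrightarrow> \<exists>i<m. z (a * m + i) \<noteq> z (b * m + i)"
        unfolding R_eq by blast
      define f where "f a = restrict (\<lambda>k. z (a * m + k)) {..<m}" for a
      have "f a \<in> slice n m P y" if "a < j" for a
        unfolding f_def using restrict_in_slice[OF P z1[OF that]] .
      moreover have "inj_on f {..<j}"
      proof (rule inj_onI)
        fix a b assume ab: "a \<in> {..<j}" "b \<in> {..<j}" "f a = f b"
        have "z (a * m + i) = z (b * m + i)" if "i < m" for i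
          using fun_cong[OF ab(3), of i] that by (simp add: f_def)
        then show "a = b" using z2 ab by blast
      qed
      ultimately show "\<exists>f. inj_on f {..<j} \<and> f ` {..<j} \<subseteq> slice n m P y" by blast
    next
      assume "\<exists>f. inj_on f {..<j} \<and> f ` {..<j} \<subseteq> slice n m P y"
      then obtain f where f: "inj_on f {..<j}" "\<And>a. a < j \<Longrightarrow> f a \<in> slice n m P y" by blast
      define z where "z k = f (k div m) (k mod m)" for k
      have z: "z (a * m + i) = f a i" if "i < m" for a i
        using that by (simp add: z_def)
      have "P (join n y (\<lambda>k. z (a * m + k)))" if "a < j" for a
        using f(2)[OF that] qf_join_cong[OF P, of "\<lambda>k. z (a * m + k)" "f a" y] z
        by (simp add: slice_def)
      moreover have "\<exists>i<m. z (a * m + i) \<noteq> z (b * m + i)" if "a < j" "b < j" "a \<noteq> b" for a b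
      proof (rule ccontr)
        assume "\<not> ?thesis"
        then have "f a i = f b i" if "i < m" for i using z that by metis
        moreover have "f a \<in> affine_space m" "f b \<in> affine_space m"
          using f(2) that by (auto simp: slice_def)
        ultimately have "f a = f b" unfolding affine_space_def by (intro PiE_ext) auto
        then show False using f(1) that by (auto dest: inj_onD)
      qed
      ultimately show "\<exists>z. R (join n y z)" unfolding R_eq by blast
    qed
  qed
  ultimately show ?thesis by simp
qed

theorem qf_slice_bounded:
  fixes P :: "(nat \<Rightarrow> 'k::alg_closed_field) \<Rightarrow> bool"
  assumes P: "P \<in> qf (n + m)"
  shows "\<exists>N. \<forall>y. finite (slice n m P y) \<longrightarrow> card (slice n m P y) \<le> N"
proof -
  have "\<exists>N. \<forall>y. finite ((\<lambda>x. x i) ` slice n m P y) \<longrightarrow> card ((\<lambda>x. x i) ` slice n m P y) \<le> N"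
    if i: "i < m" for i
  proof -
    \<comment> \<open>The value \<open>t\<close> of the projection is an additional parameter, at index \<open>n\<close>.\<close>
    define R where "R w \<longleftrightarrow> P (\<lambda>k. w (if k < n then k else Suc k)) \<and> w (Suc n + i) = w n"
      for w :: "nat \<Rightarrow> 'k"
    have "R \<in> qf (Suc n + m)"
      unfolding R_def using i by (intro qf.conj qf_rename[OF P] qf_eq_coord) auto
    then have Q: "(\<lambda>w. \<exists>z. R (join (Suc n) w z)) \<in> qf (Suc n)" by (rule qf_ex_many)
    have "{t. \<exists>z. R (join (Suc n) (y(n := t)) z)} = (\<lambda>x. x i) ` slice n m P y" for y
    proof -
      have "P (\<lambda>k. join (Suc n) (y(n := t)) z (if k < n then k else Suc k)) \<longleftrightarrow> P (join n y z)" for t z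
        by (rule arg_cong[of _ _ P]) (auto simp: join_def)
      then have R: "R (join (Suc n) (y(n := t)) z) \<longleftrightarrow> P (join n y z) \<and> z i = t" for t z
        unfolding R_def by (simp add: join_def)
      show ?thesis
      proof (intro equalityI subsetI)
        fix t assume "t \<in> {t. \<exists>z. R (join (Suc n) (y(n := t)) z)}"
        then obtain z where z: "P (join n y z)" "z i = t" unfolding R by blast
        show "t \<in> (\<lambda>x. x i) ` slice n m P y"
          by (rule image_eqI[OF _ restrict_in_slice[OF P z(1)]]) (use z i in simp)
      next
        fix t assume "t \<in> (\<lambda>x. x i) ` slice n m P y"
        then show "t \<in> {t. \<exists>z. R (join (Suc n) (y(n := t)) z)}"
          unfolding R by (auto simp: slice_def)
      qed
    qed
    then show ?thesis using qf_bounded[OF Q] by simp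
  qed
  then obtain N where N: "\<And>i y. i < m \<Longrightarrow> finite ((\<lambda>x. x i) ` slice n m P y) \<Longrightarrow>
      card ((\<lambda>x. x i) ` slice n m P y) \<le> N i" by metis
  have "card (slice n m P y) \<le> (\<Prod>i<m. N i)" if fin: "finite (slice n m P y)" for y
  proof -
    let ?B = "\<lambda>i. (\<lambda>x. x i) ` slice n m P y"
    have "slice n m P y \<subseteq> PiE {..<m} ?B"
      by (auto simp: slice_def affine_space_def PiE_def)
    then have "card (slice n m P y) \<le> card (PiE {..<m} ?B)"
      using fin by (intro card_mono finite_PiE) auto
    also have "\<dots> = (\<Prod>i<m. card (?B i))" by (simp add: card_PiE)
    also have "\<dots> \<le> (\<Prod>i<m. N i)" using fin N by (intro prod_mono) auto
    finally show ?thesis .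
  qed
  then show ?thesis by blast
qed

text \<open>A function counting points whose lower level sets are quantifier-free and whose finite values
  are bounded.  With lower bounds instead of exact values, closure under sums needs no separate
  treatment of the value infinity.\<close>

definition tame_count :: "nat \<Rightarrow> ((nat \<Rightarrow> 'k::field) \<Rightarrow> enat) \<Rightarrow> bool" where
  "tame_count n c \<longleftrightarrow>
    (\<forall>j. (\<lambda>y. enat j \<le> c y) \<in> qf n) \<and> (\<exists>N. \<forall>y j. c y = enat j \<longrightarrow> j \<le> N)"

lemma tame_count_slice:
  fixes P :: "(nat \<Rightarrow> 'k::alg_closed_field) \<Rightarrow> bool"
  assumes "P \<in> qf (n + m)" shows "tame_count n (\<lambda>y. ecard (slice n m P y))"
proof -
  obtain N where "\<And>y. finite (slice n m P y) \<Longrightarrow> card (slice n m P y) \<le> N"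
    using qf_slice_bounded[OF assms] by blast
  then have "\<forall>y j. ecard (slice n m P y) = enat j \<longrightarrow> j \<le> N"
    by (auto simp: ecard_def split: if_splits)
  then show ?thesis unfolding tame_count_def using qf_slice_card_ge[OF assms] by blast
qed

lemma enat_le_add_iff: "enat j \<le> a + b \<longleftrightarrow> (\<exists>i\<in>{..j}. enat i \<le> a \<and> enat (j - i) \<le> b)"
proof (cases a; cases b)
  fix k l assume kl: "a = enat k" "b = enat l"
  show ?thesis
  proof
    assume "enat j \<le> a + b"
    then show "\<exists>i\<in>{..j}. enat i \<le> a \<and> enat (j - i) \<le> b"
      unfolding kl by (intro bexI[of _ "min j k"]) auto
  qed (auto simp: kl)
qed (auto intro: bexI[of _ j] bexI[of _ 0])

lemma tame_count_add:
  assumes "tame_count n c" "tame_count n d" shows "tame_count n (\<lambda>y. c y + d y)"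
proof -
  obtain M N where M: "\<And>y j. c y = enat j \<Longrightarrow> j \<le> M" and N: "\<And>y j. d y = enat j \<Longrightarrow> j \<le> N"
    using assms unfolding tame_count_def by blast
  have "j \<le> M + N" if "c y + d y = enat j" for y j
    using that M[of y] N[of y] by (cases "c y"; cases "d y") fastforce+
  moreover have "(\<lambda>y. enat j \<le> c y + d y) \<in> qf n" for j
    unfolding enat_le_add_iff
    by (intro qf_Bex qf.conj) (use assms in \<open>auto simp: tame_count_def\<close>)
  ultimately show ?thesis unfolding tame_count_def by blast
qed

lemma tame_count_0: "tame_count n (\<lambda>y. 0)"
  unfolding tame_count_def by (auto simp: qf_const zero_enat_def)

lemma tame_count_sum:
  assumes "finite I" "\<And>i. i \<in> I \<Longrightarrow> tame_count n (c i)"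
  shows "tame_count n (\<lambda>y. \<Sum>i\<in>I. c i y)"
  using assms
proof (induction rule: finite_induct)
  case (insert i I)
  then show ?case using tame_count_add[of n "c i" "\<lambda>y. \<Sum>i\<in>I. c i y"] by simp
qed (simp add: tame_count_0)

lemma tame_count_level:
  assumes "tame_count n c" shows "(\<lambda>y. c y = e) \<in> qf n"
proof (cases e)
  case (enat j)
  have "c y = e \<longleftrightarrow> enat j \<le> c y \<and> \<not> enat (Suc j) \<le> c y" for y
    unfolding enat by (cases "c y") auto
  then show ?thesis using assms by (simp add: tame_count_def qf.conj qf.neg)
next
  case infinity
  obtain N where N: "\<And>y j. c y = enat j \<Longrightarrow> j \<le> N" using assms unfolding tame_count_def by blast
  have "c y = e \<longleftrightarrow> enat (Suc N) \<le> c y" for y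
    unfolding infinity using N[of y] by (cases "c y") fastforce+
  then show ?thesis using assms by (simp add: tame_count_def)
qed

section \<open>Constructible sets\<close>

lemma locally_closed_in_open: "openin T U \<Longrightarrow> locally_closed_in T U"
  unfolding locally_closed_in_def
  by (metis Int_absorb2 closedin_topspace openin_subset)

lemma locally_closed_in_closed: "closedin T C \<Longrightarrow> locally_closed_in T C"
  unfolding locally_closed_in_def
  by (metis closedin_subset inf.absorb_iff2 openin_topspace)

lemma locally_closed_in_Int:
  "locally_closed_in T A \<Longrightarrow> locally_closed_in T B \<Longrightarrow> locally_closed_in T (A \<inter> B)"
proof -
  assume "locally_closed_in T A" "locally_closed_in T B"
  then obtain U C V D where "openin T U" "closedin T C" "A = U \<inter> C"
    "openin T V" "closedin T D" "B = V \<inter> D"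
    unfolding locally_closed_in_def by blast
  then have "openin T (U \<inter> V)" "closedin T (C \<inter> D)" "A \<inter> B = (U \<inter> V) \<inter> (C \<inter> D)" by auto
  then show ?thesis unfolding locally_closed_in_def by blast
qed

lemma constructible_in_locally_closed: "locally_closed_in T A \<Longrightarrow> constructible_in T A"
  unfolding constructible_in_def by (intro exI[of _ "{A}"]) auto

lemma constructible_in_empty: "constructible_in T {}"
  unfolding constructible_in_def by (intro exI[of _ "{}"]) auto

lemma constructible_in_Un:
  assumes "constructible_in T A" "constructible_in T B"
  shows "constructible_in T (A \<union> B)"
proof -
  obtain \<A> \<B> where "finite \<A>" "\<forall>B\<in>\<A>. locally_closed_in T B" "A = \<Union>\<A>"
    "finite \<B>" "\<forall>B\<in>\<B>. locally_closed_in T B" "B = \<Union>\<B>"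
    using assms unfolding constructible_in_def by blast
  then show ?thesis unfolding constructible_in_def by (intro exI[of _ "\<A> \<union> \<B>"]) auto
qed

lemma constructible_in_UN:
  "finite I \<Longrightarrow> (\<And>i. i \<in> I \<Longrightarrow> constructible_in T (A i)) \<Longrightarrow> constructible_in T (\<Union>i\<in>I. A i)"
  by (induction rule: finite_induct) (auto intro: constructible_in_empty constructible_in_Un)

lemma constructible_in_Int:
  assumes "constructible_in T A" "constructible_in T B"
  shows "constructible_in T (A \<inter> B)"
proof -
  obtain \<A> \<B> where *: "finite \<A>" "\<forall>B\<in>\<A>. locally_closed_in T B" "A = \<Union>\<A>"
    "finite \<B>" "\<forall>B\<in>\<B>. locally_closed_in T B" "B = \<Union>\<B>"
    using assms unfolding constructible_in_def by blast
  have "constructible_in T (\<Union>X\<in>\<A>. \<Union>Y\<in>\<B>. X \<inter> Y)"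
    using * by (intro constructible_in_UN constructible_in_locally_closed locally_closed_in_Int) auto
  also have "(\<Union>X\<in>\<A>. \<Union>Y\<in>\<B>. X \<inter> Y) = A \<inter> B" using * by auto
  finally show ?thesis .
qed

lemma constructible_in_compl:
  assumes "constructible_in T A" shows "constructible_in T (topspace T - A)"
proof -
  obtain \<A> where \<A>: "finite \<A>" "\<forall>B\<in>\<A>. locally_closed_in T B" "A = \<Union>\<A>"
    using assms unfolding constructible_in_def by blast
  have "constructible_in T (topspace T - \<Union>\<A>)" using \<A>(1,2)
  proof (induction rule: finite_induct)
    case empty
    then show ?case
      by (simp add: constructible_in_locally_closed locally_closed_in_open)
  next
    case (insert B \<A>)
    obtain U C where "openin T U" "closedin T C" "B = U \<inter> C"
      using insert.prems unfolding locally_closed_in_def by auto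
    then have "constructible_in T ((topspace T - U) \<union> (topspace T - C))"
      by (intro constructible_in_Un constructible_in_locally_closed
          locally_closed_in_closed[of T "topspace T - U"] locally_closed_in_open[of T "topspace T - C"]) auto
    with insert have "constructible_in T
        ((topspace T - \<Union>\<A>) \<inter> ((topspace T - U) \<union> (topspace T - C)))"
      by (intro constructible_in_Int) auto
    also have "(topspace T - \<Union>\<A>) \<inter> ((topspace T - U) \<union> (topspace T - C)) =
        topspace T - \<Union>(insert B \<A>)" using \<open>B = U \<inter> C\<close> by auto
    finally show ?case .
  qed
  then show ?thesis using \<A>(3) by simp
qed

lemma constructible_in_preimage:
  assumes f: "continuous_map S T f" and A: "constructible_in T A"
  shows "constructible_in S {x \<in> topspace S. f x \<in> A}"
proof -
  obtain \<A> where \<A>: "finite \<A>" "\<forall>B\<in>\<A>. locally_closed_in T B" "A = \<Union>\<A>"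
    using A unfolding constructible_in_def by blast
  have "constructible_in S (\<Union>B\<in>\<A>. {x \<in> topspace S. f x \<in> B})"
  proof (rule constructible_in_UN[OF \<A>(1)])
    fix B assume "B \<in> \<A>"
    then obtain U C where UC: "openin T U" "closedin T C" "B = U \<inter> C"
      using \<A>(2) unfolding locally_closed_in_def by auto
    have "openin S {x \<in> topspace S. f x \<in> U}" "closedin S {x \<in> topspace S. f x \<in> C}"
      using openin_continuous_map_preimage[OF f UC(1)] closedin_continuous_map_preimage[OF f UC(2)] .
    from constructible_in_Int[OF this(1)[THEN locally_closed_in_open, THEN constructible_in_locally_closed]
        this(2)[THEN locally_closed_in_closed, THEN constructible_in_locally_closed]]
    show "constructible_in S {x \<in> topspace S. f x \<in> B}"
      unfolding UC(3) by (simp add: Collect_conj_eq[symmetric] conj_ac)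
  qed
  also have "(\<Union>B\<in>\<A>. {x \<in> topspace S. f x \<in> B}) = {x \<in> topspace S. f x \<in> A}"
    using \<A>(3) by auto
  finally show ?thesis .
qed

lemma constructible_in_open_subtopology:
  assumes U: "openin T U" and A: "constructible_in (subtopology T U) A"
  shows "constructible_in T A"
proof -
  obtain \<A> where \<A>: "finite \<A>" "\<forall>B\<in>\<A>. locally_closed_in (subtopology T U) B" "A = \<Union>\<A>"
    using A unfolding constructible_in_def by blast
  have "locally_closed_in T B" if "B \<in> \<A>" for B
  proof -
    obtain V C where V: "openin (subtopology T U) V" and C: "closedin (subtopology T U) C"
      and B: "B = V \<inter> C" using \<A>(2) \<open>B \<in> \<A>\<close> unfolding locally_closed_in_def by blast
    obtain C' where C': "closedin T C'" "C = C' \<inter> U" using C by (auto simp: closedin_subtopology)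
    have "openin T V" "V \<subseteq> U" using V U by (auto simp: openin_open_subtopology)
    then show ?thesis unfolding locally_closed_in_def B C' using C' by blast
  qed
  then show ?thesis unfolding constructible_in_def using \<A> by blast
qed

text \<open>The subsets of affine \<open>n\<close>-space defined by quantifier-free predicates.\<close>

definition affine_qf :: "nat \<Rightarrow> (nat \<Rightarrow> 'k::field) set \<Rightarrow> bool" where
  "affine_qf n A \<longleftrightarrow> (\<exists>P\<in>qf n. A = {x \<in> affine_space n. P x})"

lemma constructible_in_zariski:
  "P \<in> qf n \<Longrightarrow> constructible_in (zariski n) {x \<in> affine_space n. P x}"
proof (induction rule: qf.induct)
  case (zero p)
  have "algebraic_set n {x \<in> affine_space n. p x = 0}"
    unfolding algebraic_set_def zero_locus_def using zero by (intro exI[of _ "{p}"]) auto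
  then show ?case
    by (intro constructible_in_locally_closed locally_closed_in_closed) (simp add: closedin_zariski)
next
  case (neg P)
  have "topspace (zariski n) - {x \<in> affine_space n. P x} = {x \<in> affine_space n. \<not> P x}"
    by (auto simp: topspace_zariski)
  then show ?case using constructible_in_compl[OF neg.IH] by simp
next
  case (conj P Q)
  have "{x \<in> affine_space n. P x} \<inter> {x \<in> affine_space n. Q x} = {x \<in> affine_space n. P x \<and> Q x}"
    by auto
  then show ?case using constructible_in_Int[OF conj.IH] by simp
qed

text \<open>An arbitrary system of equations is equivalent to a finite one by the basis theorem.\<close>

lemma algebraic_set_affine_qf:
  assumes "algebraic_set n Z" shows "affine_qf n Z"
proof -
  obtain S where S: "S \<subseteq> poly_funs n" "Z = zero_locus n S"
    using assms unfolding algebraic_set_def by blast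
  obtain T where T: "finite T" "T \<subseteq> S" "zero_locus n T = zero_locus n S"
    using zero_locus_finite[OF S(1)] .
  have "(\<lambda>x. \<forall>p\<in>T. p x = 0) \<in> qf n"
    using T S by (intro qf_Ball qf.zero) auto
  moreover have "Z = {x \<in> affine_space n. \<forall>p\<in>T. p x = 0}"
    using S T unfolding zero_locus_def by simp
  ultimately show ?thesis unfolding affine_qf_def by (intro bexI[of _ "\<lambda>x. \<forall>p\<in>T. p x = 0"])
qed

lemma algebraic_set_subset: "algebraic_set n Z \<Longrightarrow> Z \<subseteq> affine_space n"
  unfolding algebraic_set_def zero_locus_def by auto

lemma topspace_subtopology_zariski:
  "algebraic_set n Z \<Longrightarrow> topspace (subtopology (zariski n) Z) = Z"
  using algebraic_set_subset by (auto simp: topspace_zariski)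

lemma openin_affine_qf:
  assumes Z: "algebraic_set n Z" and N: "openin (subtopology (zariski n) Z) N"
  shows "affine_qf n N"
proof -
  obtain N' where N': "openin (zariski n) N'" "N = N' \<inter> Z" using N by (auto simp: openin_subtopology)
  obtain P where P: "P \<in> qf n" "Z = {x \<in> affine_space n. P x}"
    using algebraic_set_affine_qf[OF Z] unfolding affine_qf_def by blast
  have alg: "algebraic_set n (affine_space n - N')" using N'(1) by (simp add: openin_zariski)
  obtain Q where Q: "Q \<in> qf n" "affine_space n - N' = {x \<in> affine_space n. Q x}"
    using algebraic_set_affine_qf[OF alg] unfolding affine_qf_def by blast
  have "N = {x \<in> affine_space n. P x \<and> \<not> Q x}" using N'(2) P(2) Q(2) by blast
  then show ?thesis unfolding affine_qf_def
    using qf.conj[OF P(1) qf.neg[OF Q(1)]] by (rule bexI)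
qed

section \<open>Graphs of regular functions\<close>

text \<open>The Zariski topology is Noetherian: every union of open sets is a union of finitely many of
  them.\<close>

lemma zariski_finite_subcover:
  fixes \<N> :: "(nat \<Rightarrow> 'k::field) set set"
  assumes "\<And>N. N \<in> \<N> \<Longrightarrow> openin (subtopology (zariski n) Z) N"
  obtains \<F> where "finite \<F>" "\<F> \<subseteq> \<N>" "\<Union>\<F> = \<Union>\<N>"
proof -
  have "\<exists>S. S \<subseteq> poly_funs n \<and> N = Z \<inter> (affine_space n - zero_locus n S)" if N: "N \<in> \<N>" for N
  proof -
    obtain N' where N': "openin (zariski n) N'" "N = N' \<inter> Z"
      using assms[OF N] by (auto simp: openin_subtopology)
    then obtain S where "S \<subseteq> poly_funs n" "affine_space n - N' = zero_locus n S"
      unfolding openin_zariski algebraic_set_def by blast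
    moreover have "N' \<subseteq> affine_space n" using N'(1) by (simp add: openin_zariski)
    ultimately show ?thesis using N'(2) by (intro exI[of _ S]) auto
  qed
  then obtain S where S: "\<And>N. N \<in> \<N> \<Longrightarrow> S N \<subseteq> poly_funs n"
    and N_eq: "\<And>N. N \<in> \<N> \<Longrightarrow> N = Z \<inter> (affine_space n - zero_locus n (S N))" by metis
  have "(\<Union>N\<in>\<N>. S N) \<subseteq> poly_funs n" using S by auto
  then obtain T where T: "finite T" "T \<subseteq> (\<Union>N\<in>\<N>. S N)"
    "zero_locus n T = zero_locus n (\<Union>N\<in>\<N>. S N)" by (rule zero_locus_finite)
  have "\<forall>t\<in>T. \<exists>N. N \<in> \<N> \<and> t \<in> S N" using T(2) by auto
  from bchoice[OF this] obtain h where h: "\<And>t. t \<in> T \<Longrightarrow> h t \<in> \<N> \<and> t \<in> S (h t)" by auto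
  have "\<Union>\<N> \<subseteq> \<Union>(h ` T)"
  proof
    fix x assume "x \<in> \<Union>\<N>"
    then obtain N where N: "N \<in> \<N>" "x \<in> N" by blast
    then have x: "x \<in> Z" "x \<in> affine_space n" "x \<notin> zero_locus n (S N)"
      using N_eq[OF N(1)] by auto
    have "x \<notin> zero_locus n T" unfolding T(3) using x N(1) by (auto simp: zero_locus_def)
    then obtain t where t: "t \<in> T" "t x \<noteq> 0" using x(2) by (auto simp: zero_locus_def)
    then have "x \<in> h t" using N_eq[of "h t"] h[OF t(1)] x by (auto simp: zero_locus_def)
    then show "x \<in> \<Union>(h ` T)" using t(1) by blast
  qed
  moreover have "\<Union>(h ` T) \<subseteq> \<Union>\<N>" using h by auto
  ultimately show ?thesis using that[of "h ` T"] T(1) h by auto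
qed

lemma qf_shift: "P \<in> qf m \<Longrightarrow> (\<lambda>w. P (\<lambda>i. w (n + i))) \<in> qf (n + m)"
  by (rule qf_rename) auto

lemma poly_funs_shift: "p \<in> poly_funs m \<Longrightarrow> (\<lambda>w. p (\<lambda>i. w (n + i))) \<in> poly_funs (n + m)"
  by (rule poly_funs_subst) (auto intro: poly_funs.coord)

lemma join_shift [simp]: "(\<lambda>i. join n y x (n + i)) = x"
  by (simp add: join_def)

text \<open>The graph of a regular function \<open>f\<close> on an open subset \<open>T\<close> of an affine algebraic set
  is quantifier-free.  The value of \<open>f\<close> is compared with the coordinate \<open>j\<close> of a second
  point \<open>y\<close>, which comes first in the joint coordinates.\<close>

lemma regular_function_graph:
  assumes Y: "algebraic_set m Y" and T: "openin (subtopology (zariski m) Y) T"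
    and f: "f \<in> reg (affine_model m Y) T" and j: "j < n"
  shows "\<exists>R\<in>qf (n + m). \<forall>y. \<forall>x\<in>affine_space m. R (join n y x) \<longleftrightarrow> x \<in> T \<and> y j = f x"
proof -
  let ?ok = "\<lambda>N p q. p \<in> poly_funs m \<and> q \<in> poly_funs m \<and> (\<forall>x\<in>N. q x \<noteq> 0 \<and> f x = p x / q x)"
  let ?\<N> = "{N. openin (subtopology (zariski m) Y) N \<and> N \<subseteq> T \<and> (\<exists>p q. ?ok N p q)}"
  have "\<Union>?\<N> = T"
    using f unfolding affine_model_def by fastforce
  moreover obtain \<F> where \<F>: "finite \<F>" "\<F> \<subseteq> ?\<N>" "\<Union>\<F> = \<Union>?\<N>"
    by (rule zariski_finite_subcover[of ?\<N> m Y]) auto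
  ultimately have cover: "\<Union>\<F> = T" by simp
  have "\<exists>R\<in>qf (n + m). \<forall>y. \<forall>x\<in>affine_space m. R (join n y x) \<longleftrightarrow> x \<in> N \<and> y j = f x"
    if N: "N \<in> \<F>" for N
  proof -
    obtain p q where pq: "p \<in> poly_funs m" "q \<in> poly_funs m"
      and fpq: "\<And>x. x \<in> N \<Longrightarrow> q x \<noteq> 0 \<and> f x = p x / q x" using N \<F>(2) by blast
    have "affine_qf m N" using openin_affine_qf[OF Y] N \<F>(2) by blast
    then obtain P where P: "P \<in> qf m" "N = {x \<in> affine_space m. P x}" unfolding affine_qf_def by blast
    define R where "R w \<longleftrightarrow> P (\<lambda>i. w (n + i)) \<and>
      w j * q (\<lambda>i. w (n + i)) + - p (\<lambda>i. w (n + i)) = 0" for w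
    have "R \<in> qf (n + m)" unfolding R_def
      using j by (intro qf.conj qf.zero qf_shift P(1) poly_funs.add poly_funs.mult poly_funs_minus
          poly_funs_shift pq poly_funs.coord) auto
    moreover have "R (join n y x) \<longleftrightarrow> x \<in> N \<and> y j = f x" if x: "x \<in> affine_space m" for x y
    proof -
      have "R (join n y x) \<longleftrightarrow> x \<in> N \<and> y j * q x = p x"
        unfolding R_def join_shift using x j P(2) by (auto simp: join_def)
      then show ?thesis using fpq[of x] by (auto simp: field_simps)
    qed
    ultimately show ?thesis by blast
  qed
  then obtain R where R: "\<And>N. N \<in> \<F> \<Longrightarrow> R N \<in> qf (n + m)"
    "\<And>N x y. N \<in> \<F> \<Longrightarrow> x \<in> affine_space m \<Longrightarrow> R N (join n y x) \<longleftrightarrow> x \<in> N \<and> y j = f x" by metis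
  have "(\<lambda>w. \<exists>N\<in>\<F>. R N w) \<in> qf (n + m)" using \<F>(1) R(1) by (rule qf_Bex)
  moreover have "(\<exists>N\<in>\<F>. R N (join n y x)) \<longleftrightarrow> x \<in> T \<and> y j = f x" if "x \<in> affine_space m" for x y
    using R(2)[OF _ that] cover by auto
  ultimately show ?thesis by (intro bexI[of _ "\<lambda>w. \<exists>N\<in>\<F>. R N w"]) auto
qed

section \<open>Fibres of morphisms in charts\<close>

lemma ecard_bij_betw: "bij_betw f A B \<Longrightarrow> ecard A = ecard B"
  unfolding ecard_def using bij_betw_finite bij_betw_same_card by metis

lemma ecard_Un_disjoint: "A \<inter> B = {} \<Longrightarrow> ecard (A \<union> B) = ecard A + ecard B"
  by (auto simp: ecard_def card_Un_disjoint)

lemma ecard_UN_disjoint: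
  assumes "finite I" "\<And>i j. i \<in> I \<Longrightarrow> j \<in> I \<Longrightarrow> i \<noteq> j \<Longrightarrow> A i \<inter> A j = {}"
  shows "ecard (\<Union>i\<in>I. A i) = (\<Sum>i\<in>I. ecard (A i))"
  using assms
proof (induction rule: finite_induct)
  case empty
  show ?case by (simp add: ecard_def zero_enat_def)
next
  case (insert i I)
  have "A i \<inter> (\<Union>i\<in>I. A i) = {}" using insert.prems insert.hyps by fastforce
  then have "ecard (A i \<union> (\<Union>i\<in>I. A i)) = ecard (A i) + ecard (\<Union>i\<in>I. A i)"
    by (rule ecard_Un_disjoint)
  moreover have "ecard (\<Union>i\<in>I. A i) = (\<Sum>i\<in>I. ecard (A i))"
    using insert.IH insert.prems by blast
  ultimately show ?case using insert.hyps by simp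
qed

text \<open>An affine chart of \<open>X\<close>: an open set \<open>U\<close> with an isomorphism \<open>\<phi>\<close> onto the affine
  algebraic set \<open>Z\<close> in \<open>n\<close>-space, and its inverse \<open>\<psi>\<close>.\<close>

definition affine_chart ::
    "('a, 'k::field) fspace \<Rightarrow> 'a set \<Rightarrow> nat \<Rightarrow> (nat \<Rightarrow> 'k) set \<Rightarrow>
      ('a \<Rightarrow> nat \<Rightarrow> 'k) \<Rightarrow> ((nat \<Rightarrow> 'k) \<Rightarrow> 'a) \<Rightarrow> bool" where
  "affine_chart X U n Z \<phi> \<psi> \<longleftrightarrow> openin (ztop X) U \<and> algebraic_set n Z \<and>
    regular_morphism (open_subspace X U) (affine_model n Z) \<phi> \<and>
    regular_morphism (affine_model n Z) (open_subspace X U) \<psi> \<and>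
    (\<forall>x\<in>U. \<psi> (\<phi> x) = x) \<and> (\<forall>y\<in>Z. \<phi> (\<psi> y) = y)"

lemma prevariety_charts:
  assumes "prevariety X"
  obtains \<U> where "finite \<U>" "\<Union>\<U> = topspace (ztop X)" 
    "\<forall>U\<in>\<U>. \<exists>n Z \<phi> \<psi>. affine_chart X U n Z \<phi> \<psi>"
proof -
  obtain \<U> where \<U>: "finite \<U>" "\<Union>\<U> = topspace (ztop X)" and iso: "\<forall>U\<in>\<U>. openin (ztop X) U \<and>
      (\<exists>n Z. algebraic_set n Z \<and> isomorphic (open_subspace X U) (affine_model n Z))"
    using assms unfolding prevariety_def by (elim conjE exE)
  have "\<exists>n Z \<phi> \<psi>. affine_chart X U n Z \<phi> \<psi>" if U: "U \<in> \<U>" for U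
  proof -
    obtain n Z where Z: "openin (ztop X) U" "algebraic_set n Z"
      "isomorphic (open_subspace X U) (affine_model n Z)" using bspec[OF iso U] by (elim conjE exE)
    have top: "topspace (ztop (open_subspace X U)) = U" "topspace (ztop (affine_model n Z)) = Z"
      using openin_subset[OF Z(1)] algebraic_set_subset[OF Z(2)]
      by (auto simp: open_subspace_def affine_model_def topspace_zariski)
    obtain \<phi> \<psi> where "regular_morphism (open_subspace X U) (affine_model n Z) \<phi>"
      "regular_morphism (affine_model n Z) (open_subspace X U) \<psi>"
      "\<forall>x\<in>U. \<psi> (\<phi> x) = x" "\<forall>y\<in>Z. \<phi> (\<psi> y) = y"
      using Z(3) unfolding isomorphic_def top by (elim exE conjE)
    then have "affine_chart X U n Z \<phi> \<psi>" using Z(1,2) unfolding affine_chart_def by simp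
    then show ?thesis by (intro exI)
  qed
  then show ?thesis by (intro that[OF \<U>] ballI)
qed

lemma affine_chartD:
  assumes "affine_chart X U n Z \<phi> \<psi>"
  shows "openin (ztop X) U" "algebraic_set n Z"
    "continuous_map (subtopology (ztop X) U) (subtopology (zariski n) Z) \<phi>"
    "continuous_map (subtopology (zariski n) Z) (subtopology (ztop X) U) \<psi>"
    "x \<in> U \<Longrightarrow> \<psi> (\<phi> x) = x" "y \<in> Z \<Longrightarrow> \<phi> (\<psi> y) = y"
    "x \<in> U \<Longrightarrow> \<phi> x \<in> Z" "y \<in> Z \<Longrightarrow> \<psi> y \<in> U"
proof -
  show U: "openin (ztop X) U" and Z: "algebraic_set n Z"
    and \<phi>: "continuous_map (subtopology (ztop X) U) (subtopology (zariski n) Z) \<phi>"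
    and \<psi>: "continuous_map (subtopology (zariski n) Z) (subtopology (ztop X) U) \<psi>"
    using assms by (simp_all add: affine_chart_def regular_morphism_def open_subspace_def affine_model_def)
  have top: "topspace (subtopology (ztop X) U) = U" using openin_subset[OF U] by auto
  show "x \<in> U \<Longrightarrow> \<psi> (\<phi> x) = x" "y \<in> Z \<Longrightarrow> \<phi> (\<psi> y) = y"
    using assms by (simp_all add: affine_chart_def)
  show "x \<in> U \<Longrightarrow> \<phi> x \<in> Z" "y \<in> Z \<Longrightarrow> \<psi> y \<in> U"
    using \<phi> \<psi> unfolding continuous_map_def top topspace_subtopology_zariski[OF Z] by auto
qed

lemma coordinate_regular:
  assumes "j < n" "openin (subtopology (zariski n) Z) U"
  shows "(\<lambda>x. x j) \<in> reg (affine_model n Z) U"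
proof -
  have "\<forall>y\<in>U. (1::'a) \<noteq> 0 \<and> y j = y j / 1" by simp
  moreover have "(\<lambda>x. x j) \<in> poly_funs n" using assms(1) by (rule poly_funs.coord)
  moreover have "(\<lambda>x. 1) \<in> poly_funs n" by (rule poly_funs.const)
  ultimately have "\<exists>p\<in>poly_funs n. \<exists>q\<in>poly_funs n. \<forall>y\<in>U. q y \<noteq> 0 \<and> y j = p y / q y"
    by (intro bexI[of _ "\<lambda>x. x j"] bexI[of _ "\<lambda>x. 1"])
  then show ?thesis using assms(2) unfolding affine_model_def by auto
qed

text \<open>The graph of \<open>u\<close>, restricted to the part of the chart \<open>V0\<close> outside an open set
  \<open>O1\<close>, is quantifier-free in the coordinates of the charts \<open>U\<close> and \<open>V0\<close>.\<close>

lemma morphism_graph_qf: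
  assumes V: "space_with_functions V" and u: "regular_morphism V W u"
    and V0: "affine_chart V V0 m Y \<alpha> \<beta>" and U: "affine_chart W U n Z \<phi> \<psi>"
    and O1: "openin (ztop V) O1"
  shows "\<exists>P\<in>qf (n + m). \<forall>w\<in>U. slice n m P (\<phi> w) = {x \<in> Y. \<beta> x \<notin> O1 \<and> u (\<beta> x) = w}"
proof -
  note OD = affine_chartD[OF V0] and UD = affine_chartD[OF U]
  have u_cont: "continuous_map (ztop V) (ztop W) u" using u by (simp add: regular_morphism_def)
  define preU where "preU = {v \<in> topspace (ztop V). u v \<in> U}"
  have preU: "openin (ztop V) preU"
    unfolding preU_def by (rule openin_continuous_map_preimage[OF u_cont UD(1)])
  have topY: "topspace (subtopology (zariski m) Y) = Y" by (rule topspace_subtopology_zariski[OF OD(2)])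
  have pre_open: "openin (subtopology (zariski m) Y) {x \<in> Y. \<beta> x \<in> A}" if "openin (ztop V) A" for A
  proof -
    have "openin (subtopology (ztop V) V0) (A \<inter> V0)" using that by (auto simp: openin_subtopology)
    from openin_continuous_map_preimage[OF OD(4) this]
    have "openin (subtopology (zariski m) Y) {x \<in> Y. \<beta> x \<in> A \<inter> V0}" unfolding topY .
    moreover have "{x \<in> Y. \<beta> x \<in> A \<inter> V0} = {x \<in> Y. \<beta> x \<in> A}" using OD(8) by auto
    ultimately show ?thesis by simp
  qed
  define T where "T = {x \<in> Y. \<beta> x \<in> preU}"
  have T: "openin (subtopology (zariski m) Y) T" unfolding T_def by (rule pre_open[OF preU])
  have T_iff: "x \<in> T \<longleftrightarrow> x \<in> Y \<and> u (\<beta> x) \<in> U" for x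
    using OD(8)[of x] openin_subset[OF OD(1)] by (auto simp: T_def preU_def)
  \<comment> \<open>The coordinate \<open>j\<close> of the codomain is pulled back along the chart of the codomain,
    the morphism and the chart of the domain in turn.\<close>
  have reg: "(\<lambda>x. \<phi> (u (\<beta> x)) j) \<in> reg (affine_model m Y) T" if j: "j < n" for j
  proof -
    have "openin (subtopology (zariski n) Z) Z"
      using openin_topspace[of "subtopology (zariski n) Z"] topspace_subtopology_zariski[OF UD(2)] by simp
    then have coord: "(\<lambda>x. x j) \<in> reg (affine_model n Z) Z" "openin (ztop (affine_model n Z)) Z"
      using coordinate_regular[OF j] by (simp_all add: affine_model_def)
    have "regular_morphism (open_subspace W U) (affine_model n Z) \<phi>"
      using U by (simp add: affine_chart_def)
    then have "(\<lambda>x. x j) \<circ> \<phi> \<in> reg (open_subspace W U)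
        {x \<in> topspace (ztop (open_subspace W U)). \<phi> x \<in> Z}"
      using coord unfolding regular_morphism_def by blast
    also have "{x \<in> topspace (ztop (open_subspace W U)). \<phi> x \<in> Z} = U"
      using UD(7) openin_subset[OF UD(1)] by (auto simp: open_subspace_def)
    finally have "(\<lambda>x. x j) \<circ> \<phi> \<in> reg W U" by (simp add: open_subspace_def comp_def)
    then have "((\<lambda>x. x j) \<circ> \<phi>) \<circ> u \<in> reg V preU"
      using u UD(1) unfolding regular_morphism_def preU_def by blast
    moreover have open_Int: "openin (ztop V) (V0 \<inter> preU)" using preU OD(1) by blast
    ultimately have "((\<lambda>x. x j) \<circ> \<phi>) \<circ> u \<in> reg V (V0 \<inter> preU)"
      using V preU unfolding space_with_functions_def by (meson Int_lower2)
    then have "((\<lambda>x. x j) \<circ> \<phi>) \<circ> u \<in> reg (open_subspace V V0) (V0 \<inter> preU)"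
      by (simp add: open_subspace_def)
    moreover have "openin (ztop (open_subspace V V0)) (V0 \<inter> preU)"
      using preU by (auto simp: open_subspace_def openin_subtopology)
    moreover have "regular_morphism (affine_model m Y) (open_subspace V V0) \<beta>"
      using V0 by (simp add: affine_chart_def)
    ultimately have "(((\<lambda>x. x j) \<circ> \<phi>) \<circ> u) \<circ> \<beta> \<in> reg (affine_model m Y)
        {x \<in> topspace (ztop (affine_model m Y)). \<beta> x \<in> V0 \<inter> preU}"
      unfolding regular_morphism_def by blast
    also have "{x \<in> topspace (ztop (affine_model m Y)). \<beta> x \<in> V0 \<inter> preU} = T"
      using OD(8) topY by (auto simp: affine_model_def T_def)
    finally show ?thesis by (simp add: comp_def)
  qed
  have "\<exists>R\<in>qf (n + m). \<forall>y. \<forall>x\<in>affine_space m. R (join n y x) \<longleftrightarrow> x \<in> T \<and> y j = \<phi> (u (\<beta> x)) j"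
    if "j < n" for j
    by (rule regular_function_graph[OF OD(2) T reg[OF that] that])
  then obtain R where R: "\<And>j. j < n \<Longrightarrow> R j \<in> qf (n + m)"
    and R_iff: "\<And>j x y. j < n \<Longrightarrow> x \<in> affine_space m \<Longrightarrow>
      R j (join n y x) \<longleftrightarrow> x \<in> T \<and> y j = \<phi> (u (\<beta> x)) j" by metis
  obtain PT where PT: "PT \<in> qf m" "T = {x \<in> affine_space m. PT x}"
    using openin_affine_qf[OF OD(2) T] unfolding affine_qf_def by blast
  obtain P1 where P1: "P1 \<in> qf m" "{x \<in> Y. \<beta> x \<in> O1} = {x \<in> affine_space m. P1 x}"
    using openin_affine_qf[OF OD(2) pre_open[OF O1]] unfolding affine_qf_def by blast
  define P where "P w \<longleftrightarrow> PT (\<lambda>i. w (n + i)) \<and> \<not> P1 (\<lambda>i. w (n + i)) \<and> (\<forall>j\<in>{..<n}. R j w)" for w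
  have "P \<in> qf (n + m)" unfolding P_def
    by (intro qf.conj qf.neg qf_shift PT(1) P1(1) qf_Ball R finite_lessThan) simp
  moreover have "slice n m P (\<phi> w) = {x \<in> Y. \<beta> x \<notin> O1 \<and> u (\<beta> x) = w}" if w: "w \<in> U" for w
  proof (intro set_eqI)
    fix x
    have "x \<in> slice n m P (\<phi> w) \<longleftrightarrow> x \<in> T \<and> \<beta> x \<notin> O1 \<and> (\<forall>j<n. \<phi> w j = \<phi> (u (\<beta> x)) j)"
    proof (cases "x \<in> affine_space m")
      case True
      have "PT x \<longleftrightarrow> x \<in> T" "P1 x \<longleftrightarrow> x \<in> Y \<and> \<beta> x \<in> O1" using PT(2) P1(2) True by blast+
      then show ?thesis using True R_iff[OF _ True] T_iff[of x] by (auto simp: slice_def P_def)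
    next
      case False
      then show ?thesis using PT(2) by (auto simp: slice_def)
    qed
    also have "\<dots> \<longleftrightarrow> x \<in> T \<and> \<beta> x \<notin> O1 \<and> \<phi> w = \<phi> (u (\<beta> x))"
    proof -
      have "\<phi> w = \<phi> (u (\<beta> x))" if "x \<in> T" "\<forall>j<n. \<phi> w j = \<phi> (u (\<beta> x)) j"
      proof -
        have "\<phi> w \<in> affine_space n" "\<phi> (u (\<beta> x)) \<in> affine_space n"
          using UD(7) w that(1) T_iff algebraic_set_subset[OF UD(2)] by blast+
        then show ?thesis using that(2) unfolding affine_space_def by (intro PiE_ext) auto
      qed
      then show ?thesis by auto
    qed
    also have "\<dots> \<longleftrightarrow> x \<in> Y \<and> \<beta> x \<notin> O1 \<and> u (\<beta> x) = w"
      using T_iff[of x] UD(5)[OF w] UD(5)[of "u (\<beta> x)"] w by metis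
    finally show "x \<in> slice n m P (\<phi> w) \<longleftrightarrow> x \<in> {x \<in> Y. \<beta> x \<notin> O1 \<and> u (\<beta> x) = w}" by simp
  qed
  ultimately show ?thesis by blast
qed

lemma chart_fibre_count:
  fixes V :: "('a, 'k::alg_closed_field) fspace"
  assumes V: "space_with_functions V" and u: "regular_morphism V W u"
    and V0: "affine_chart V V0 m Y \<alpha> \<beta>" and U: "affine_chart W U n Z \<phi> \<psi>"
    and O1: "openin (ztop V) O1"
  shows "\<exists>c. tame_count n c \<and> (\<forall>w\<in>U. ecard {v \<in> V0 - O1. u v = w} = c (\<phi> w))"
proof -
  note OD = affine_chartD[OF V0]
  obtain P where P: "P \<in> qf (n + m)"
    "\<And>w. w \<in> U \<Longrightarrow> slice n m P (\<phi> w) = {x \<in> Y. \<beta> x \<notin> O1 \<and> u (\<beta> x) = w}"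
    using morphism_graph_qf[OF assms] by blast
  have "ecard {v \<in> V0 - O1. u v = w} = ecard (slice n m P (\<phi> w))" if "w \<in> U" for w
  proof -
    have "bij_betw \<beta> {x \<in> Y. \<beta> x \<notin> O1 \<and> u (\<beta> x) = w} {v \<in> V0 - O1. u v = w}"
      by (rule bij_betw_byWitness[where f' = \<alpha>]) (use OD(5-8) in auto)
    from ecard_bij_betw[OF this] show ?thesis using P(2)[OF that] by simp
  qed
  with tame_count_slice[OF P(1)] show ?thesis by blast
qed

text \<open>Replacing a finite cover by charts by the differences of each chart and the previous ones makes
  the cover disjoint, so that the numbers of points of a fibre in its members add up.\<close>

lemma fibre_count_tame:
  fixes V :: "('a, 'k::alg_closed_field) fspace"
  assumes V: "prevariety V" and u: "regular_morphism V W u" and U: "affine_chart W U n Z \<phi> \<psi>"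
  shows "\<exists>c. tame_count n c \<and> (\<forall>w\<in>U. ecard (fibre V u w) = c (\<phi> w))"
proof -
  obtain \<O> where \<O>: "finite \<O>" "\<Union>\<O> = topspace (ztop V)"
    "\<forall>V0\<in>\<O>. \<exists>m Y \<alpha> \<beta>. affine_chart V V0 m Y \<alpha> \<beta>"
    using prevariety_charts[OF V] .
  obtain A where A: "bij_betw A {0..<card \<O>} \<O>" using ex_bij_betw_nat_finite[OF \<O>(1)] ..
  let ?I = "{0..<card \<O>}"
  have V': "space_with_functions V" using V by (simp add: prevariety_def)
  have AO: "A i \<in> \<O>" if "i \<in> ?I" for i using A that by (auto simp: bij_betw_def)
  have "\<exists>c. tame_count n c \<and> (\<forall>w\<in>U. ecard {v \<in> disjointed A i. u v = w} = c (\<phi> w))"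
    if i: "i \<in> ?I" for i
  proof -
    obtain m Y \<alpha> \<beta> where chart: "affine_chart V (A i) m Y \<alpha> \<beta>" using bspec[OF \<O>(3) AO[OF i]] by blast
    have "openin (ztop V) (A j)" if "j \<in> {0..<i}" for j
      using bspec[OF \<O>(3) AO[of j]] that i affine_chartD(1) by fastforce
    then have "openin (ztop V) (\<Union>j\<in>{0..<i}. A j)" by blast
    from chart_fibre_count[OF V' u chart U this] show ?thesis unfolding disjointed_def .
  qed
  then obtain c where c: "\<And>i. i \<in> ?I \<Longrightarrow> tame_count n (c i)"
    "\<And>i w. i \<in> ?I \<Longrightarrow> w \<in> U \<Longrightarrow> ecard {v \<in> disjointed A i. u v = w} = c i (\<phi> w)" by metis
  have cover: "topspace (ztop V) = (\<Union>i\<in>?I. disjointed A i)"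
    using A \<O>(2) by (simp add: finite_UN_disjointed_eq bij_betw_def)
  have "ecard (fibre V u w) = (\<Sum>i\<in>?I. c i (\<phi> w))" if "w \<in> U" for w
  proof -
    have "fibre V u w = (\<Union>i\<in>?I. {v \<in> disjointed A i. u v = w})" unfolding fibre_def cover by auto
    also have "ecard \<dots> = (\<Sum>i\<in>?I. ecard {v \<in> disjointed A i. u v = w})"
      using disjoint_family_disjointed[of A]
      by (intro ecard_UN_disjoint) (auto simp: disjoint_family_on_def)
    finally show ?thesis using c(2) that by simp
  qed
  moreover have "tame_count n (\<lambda>y. \<Sum>i\<in>?I. c i y)" using c(1) by (intro tame_count_sum) auto
  ultimately show ?thesis by blast
qed

lemma chart_fibre_locus:
  fixes V :: "('a, 'k::alg_closed_field) fspace"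
  assumes V: "prevariety V" and u: "regular_morphism V W u" and U: "affine_chart W U n Z \<phi> \<psi>"
  shows "constructible_in (ztop W) (fibre_card_locus V W u e \<inter> U)"
    and "\<exists>N. \<forall>j>N. fibre_card_locus V W u (enat j) \<inter> U = {}"
proof -
  note UD = affine_chartD[OF U]
  obtain c where c: "tame_count n c" "\<And>w. w \<in> U \<Longrightarrow> ecard (fibre V u w) = c (\<phi> w)"
    using fibre_count_tame[OF assms] by blast
  have UW: "U \<subseteq> topspace (ztop W)" using openin_subset[OF UD(1)] .
  have "constructible_in (zariski n) {x \<in> affine_space n. c x = e}"
    by (rule constructible_in_zariski[OF tame_count_level[OF c(1)]])
  moreover have "continuous_map (subtopology (ztop W) U) (zariski n) \<phi>"
    using UD(3) by (simp add: continuous_map_in_subtopology)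
  ultimately have "constructible_in (subtopology (ztop W) U)
      {w \<in> topspace (subtopology (ztop W) U). \<phi> w \<in> {x \<in> affine_space n. c x = e}}"
    by (rule constructible_in_preimage[rotated])
  also have "{w \<in> topspace (subtopology (ztop W) U). \<phi> w \<in> {x \<in> affine_space n. c x = e}} =
      fibre_card_locus V W u e \<inter> U"
    using UW UD(7) algebraic_set_subset[OF UD(2)] c(2) by (auto simp: fibre_card_locus_def)
  finally show "constructible_in (ztop W) (fibre_card_locus V W u e \<inter> U)"
    by (rule constructible_in_open_subtopology[OF UD(1)])
  obtain N where "\<And>y j. c y = enat j \<Longrightarrow> j \<le> N" using c(1) unfolding tame_count_def by blast
  then have "fibre_card_locus V W u (enat j) \<inter> U = {}" if "N < j" for j
    using c(2) that by (force simp: fibre_card_locus_def)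
  then show "\<exists>N. \<forall>j>N. fibre_card_locus V W u (enat j) \<inter> U = {}" by blast
qed

theorem theorem2:
  fixes V :: "('a, 'k::alg_closed_field) fspace"
    and W :: "('b, 'k) fspace"
    and u :: "'a \<Rightarrow> 'b"
  assumes "variety V" and "variety W" and "regular_morphism V W u"
  shows "(\<forall>m::enat. constructible_in (ztop W) (fibre_card_locus V W u m)) \<and>
    (\<exists>l::int. \<forall>j::nat. l < int j \<longrightarrow> fibre_card_locus V W u (enat j) = {})"
proof -
  have V: "prevariety V" and W: "prevariety W" using assms by (simp_all add: variety_def)
  obtain \<U> where \<U>: "finite \<U>" "\<Union>\<U> = topspace (ztop W)"
    "\<forall>U\<in>\<U>. \<exists>n Z \<phi> \<psi>. affine_chart W U n Z \<phi> \<psi>"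
    using prevariety_charts[OF W] .
  have cover: "fibre_card_locus V W u e = (\<Union>U\<in>\<U>. fibre_card_locus V W u e \<inter> U)" for e
    using \<U>(2) by (auto simp: fibre_card_locus_def)
  have "constructible_in (ztop W) (fibre_card_locus V W u e)" for e
    by (subst cover, rule constructible_in_UN[OF \<U>(1)])
      (use \<U>(3) chart_fibre_locus(1)[OF V assms(3)] in blast)
  moreover have "\<exists>N. \<forall>j>N. fibre_card_locus V W u (enat j) \<inter> U = {}" if "U \<in> \<U>" for U
    using bspec[OF \<U>(3) that] chart_fibre_locus(2)[OF V assms(3)] by blast
  then obtain N where N: "\<And>U j. U \<in> \<U> \<Longrightarrow> j > N U \<Longrightarrow> fibre_card_locus V W u (enat j) \<inter> U = {}"
    by metis
  have "fibre_card_locus V W u (enat j) = {}" if j: "int (\<Sum>U\<in>\<U>. N U) < int j" for j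
  proof -
    have "(\<Sum>U\<in>\<U>. N U) < j" using j by (simp only: of_nat_less_iff)
    then have "fibre_card_locus V W u (enat j) \<inter> U = {}" if "U \<in> \<U>" for U
      using N[OF that, of j] member_le_sum[of U \<U> N] \<U>(1) that by simp
    then show ?thesis by (subst cover) blast
  qed
  ultimately show ?thesis by blast
qed

end
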